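(* Let $z(\hbar_{\mathrm{ren}})=z_{\varphi_c\psi_c\bar\psi_c}(\hbar_{\mathrm{ren}})$ be the vertex renormalization constant of zero-dimensional quenched QED. There are real numbers $c_0,c_1,\dots$ such that for every $R\ge0$, as $n\to\infty$, $$[\hbar_{\mathrm{ren}}^n]\big(1-z(\hbar_{\mathrm{ren}})\big)=e^{-2}\sum_{k=0}^{R-1}c_k\,(2n+1-2k)!!+\mathcal{O}\big((2n+1-2R)!!\big),$$ with $c_0=1$, $c_1=-6$, $c_2=-4$, $c_3=-\frac{218}{3}$; equivalently, $$[\hbar_{\mathrm{ren}}^n](1-z)\sim e^{-2}(2n+1)!!\left(1-\frac{6}{2n+1}-\frac{4}{(2n-1)(2n+1)}-\frac{218}{3}\frac{1}{(2n-3)(2n-1)(2n+1)}+\cdots\right).$$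
   Context: Let $\chi(\hbar)=\sum_{n\ge0}(2n-1)!!\,\hbar^n$ with $(-1)!!=1$. The effective action of zero-dimensional quenched QED is $G(\hbar,\varphi_c,\psi_c)=-\frac{\varphi_c^2}{2}+|\psi_c|^2\frac{\varphi_c-1}{\chi\left(\hbar/(1-\varphi_c)^2\right)}+\mathcal{O}(|\psi_c|^4)$. Hence, at $\varphi_c=\psi_c=0$, $G_{\psi\bar\psi}(\hbar)=\partial_{\psi_c}\partial_{\bar\psi_c}G=-\frac{1}{\chi(\hbar)}$ and $G_{\varphi\psi\bar\psi}(\hbar)=\partial_{\varphi_c}\partial_{\psi_c}\partial_{\bar\psi_c}G=\partial_{\varphi_c}\left.\frac{\varphi_c-1}{\chi\left(\hbar/(1-\varphi_c)^2\right)}\right|_{\varphi_c=0}$. Renormalization: the squared invariant charge is $\alpha(\hbar)=\left(\frac{G_{\varphi\psi\bar\psi}}{-G_{\psi\bar\psi}}\right)^2$; $\hbar(\hbar_{\mathrm{ren}})=\hbar_{\mathrm{ren}}+\cdots$ is the unique power series with $\hbar_{\mathrm{ren}}=\hbar(\hbar_{\mathrm{ren}})\,\alpha(\hbar(\hbar_{\mathrm{ren}}))$; and $z_{\varphi_c\psi_c\bar\psi_c}(\hbar_{\mathrm{ren}})=1/G_{\varphi\psi\bar\psi}(\hbar(\hbar_{\mathrm{ren}}))=1-\hbar_{\mathrm{ren}}-\hbar_{\mathrm{ren}}^2-7\hbar_{\mathrm{ren}}^3-\cdots$. *)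

theory Defs
  imports
    "HOL-Computational_Algebra.Formal_Power_Series"
    "HOL-Library.Landau_Symbols"
begin

fun dfact :: "nat \<Rightarrow> nat" where
  "dfact 0 = 1"
| "dfact (Suc 0) = 1"
| "dfact (Suc (Suc n)) = Suc (Suc n) * dfact n"

text \<open>
  For \<open>n = 0\<close> truncated subtraction gives \<open>dfact (2 * 0 - 1) = dfact 0 = 1\<close>, in agreement with
  the convention \<open>(-1)!! = 1\<close>. The series is polymorphic because it is used below over both
  \<open>\<real>\<close> and \<open>\<real>[[\<phi>]]\<close>.
\<close>

definition chi :: "'a::semiring_1 fps" where
  "chi = Abs_fps (\<lambda>n. of_nat (dfact (2 * n - 1)))"

text \<open>
  The coefficient of \<open>|\<psi>|\<^sup>2\<close> in the effective action, i.e. its derivative with respect to \<open>\<psi>\<close> and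
  its conjugate at \<open>\<psi> = 0\<close>:
  \<open>(\<phi> - 1) / \<chi>(\<hbar> / (1 - \<phi>)\<^sup>2)\<close>. It is an element of \<open>\<real>[[\<phi>]][[\<hbar>]]\<close>: the outer
  variable is \<open>\<hbar>\<close> and the inner variable is \<open>\<phi>\<close>.
\<close>

definition G2 :: "real fps fps" where
  "G2 = fps_const (fps_X - 1) *
          inverse (chi oo (fps_X * fps_const (inverse ((1 - fps_X) ^ 2))))"

definition G_psi_psibar :: "real fps" where
  "G_psi_psibar = Abs_fps (\<lambda>n. fps_nth (fps_nth G2 n) 0)"

definition G_phi_psi_psibar :: "real fps" where
  "G_phi_psi_psibar = Abs_fps (\<lambda>n. fps_nth (fps_deriv (fps_nth G2 n)) 0)"

definition alpha :: "real fps" where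
  "alpha = (G_phi_psi_psibar / (- G_psi_psibar)) ^ 2"

definition is_hbar :: "real fps \<Rightarrow> bool" where
  "is_hbar h \<longleftrightarrow> fps_nth h 0 = 0 \<and> fps_nth h 1 = 1 \<and> fps_X = h * (alpha oo h)"

definition hbar :: "real fps" where
  "hbar = (THE h. is_hbar h)"

definition z_vertex :: "real fps" where
  "z_vertex = 1 / (G_phi_psi_psibar oo hbar)"


lemma chi_nth_0 [simp]: "fps_nth chi 0 = 1"
  by (simp add: chi_def)

lemma chi_compose_nth_0: "fps_nth (chi oo (fps_X * b)) 0 = (1 :: 'a::comm_ring_1)"
  by (simp add: fps_compose_nth)

lemma G2_nth_0: "fps_nth G2 0 = fps_X - 1"
proof -
  have "fps_nth (inverse (chi oo (fps_X * fps_const (inverse ((1 - fps_X) ^ 2 :: real fps))))) 0 = 1"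
    by (subst fps_inverse_def) (simp add: chi_compose_nth_0)
  thus ?thesis by (simp add: G2_def)
qed

lemma alpha_nth_0: "fps_nth alpha 0 = 1"
proof -
  have a: "fps_nth G_psi_psibar 0 = -1" "fps_nth G_phi_psi_psibar 0 = 1"
    by (simp_all add: G_psi_psibar_def G_phi_psi_psibar_def G2_nth_0)
  then show ?thesis
    by (simp add: alpha_def fps_divide_unit power2_eq_square)
qed

text \<open>The renormalized expansion parameter is well defined.\<close>

lemma ex1_is_hbar: "\<exists>!h. is_hbar h"
proof -
  define a where "a = fps_X * alpha"
  have a01: "fps_nth a 0 = 0" "fps_nth a 1 = 1"
    by (simp_all add: a_def alpha_nth_0)
  have eq: "a oo h = h * (alpha oo h)" if "fps_nth h 0 = 0" for h
    using that by (simp add: a_def fps_compose_mult_distrib)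
  show ?thesis
  proof (rule ex1I)
    have "fps_nth (fps_inv a) 0 = 0" "fps_nth (fps_inv a) 1 = 1"
      using a01 by (simp_all add: fps_inv_def)
    moreover have "a oo fps_inv a = fps_X"
      by (rule fps_inv_right) (use a01 in auto)
    ultimately show "is_hbar (fps_inv a)"
      using eq by (simp add: is_hbar_def)
  next
    fix h assume "is_hbar h"
    hence h: "fps_nth h 0 = 0" "a oo h = fps_X"
      using eq by (auto simp: is_hbar_def)
    have "h = (fps_inv a oo a) oo h"
      using a01 h by (simp add: fps_inv)
    also have "\<dots> = fps_inv a oo (a oo h)"
      by (rule fps_compose_assoc [symmetric]) (use a01 h in auto)
    finally show "h = fps_inv a" using h by simp
  qed
qed

end

(*
  Write a(x) = x alpha(x), chi = 1 + x kappa and tau = kappa / chi. Everything is expressed through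
  tau, which solves a Riccati equation: alpha = tau^2, and y = 1 - z satisfies y o a = Y with
  Y = 1 - 1 / (tau (1 - x tau)). Eliminating tau gives
    2 x y y' = (1 - y) (y - x (1 - y)),
  a quadratic recurrence for the coefficients of y. Since the coefficients (2n+1)!! of kappa grow so
  fast, only the extreme terms of a convolution matter, and the recurrence is asymptotically linear.
  Its linearization has a formal solution kappa * c, where the generating function c of the c_k
  solves a first-order linear differential equation; hence y_n has an expansion
  C (c_0 (2n+1)!! + c_1 (2n-1)!! + ...) with some constant C.

  To find C, compare coefficients in Y = y o a: Y_m is the sum over j of
  y_{m-j} [x^j] alpha^(m-j), which for fixed j is asymptotic to C (2m+1)!! 2^j / j!, while
  Y_m is asymptotic to (2m+1)!!. All terms are nonnegative and the mean of j is bounded,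
  so the limit may be taken termwise: 1 = C e^2.
*)
theory Submission
  imports Defs
begin

section \<open>Series with coefficients of odd double factorial growth\<close>


text \<open>The obstacle is the inverse series hidden in z: y is tied to known series only through y
  o a = Y, where a itself diverges factorially, so the growth of y cannot be read off from a closed
  formula. Positivity replaces analytic control: the j = 0 term of Y_m is y_m itself, so y_m is at
  most Y_m, and tails of the sum can be estimated by their mean. The two routes to y complement each
  other. The linearized recurrence determines the shape of the expansion to every order, and also
  the existence of the limit C, but it is homogeneous and cannot see the value of C. The composition
  is only understood to leading order, which is exactly what the value of C needs. The linearization
  must be taken at a truncation of y, not at y: for a small error e the product y e still contains
  the term y_n e_0, which is as large as (2n+1)!!.\<close>

definition odf :: "nat \<Rightarrow> real" where
  "odf n = real (dfact (2 * n + 1))"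

lemma odf_0 [simp]: "odf 0 = 1"
  by (simp add: odf_def)

lemma odf_Suc: "odf (Suc n) = (2 * real n + 3) * odf n"
  by (simp add: odf_def algebra_simps)

lemma odf_pos [simp]: "odf n > 0"
  by (induction n) (auto simp: odf_Suc intro!: mult_pos_pos)

lemma odf_nonneg [simp]: "odf n \<ge> 0"
  using odf_pos[of n] by linarith

lemma odf_nz [simp]: "odf n \<noteq> 0"
  using odf_pos[of n] by linarith

lemma odf_mono: "m \<le> n \<Longrightarrow> odf m \<le> odf n"
proof (rule lift_Suc_mono_le[of odf])
  fix k
  have "1 * odf k \<le> (2 * real k + 3) * odf k"
    by (intro mult_right_mono) auto
  thus "odf k \<le> odf (Suc k)" by (simp add: odf_Suc)
qed

lemma odf_ge_1: "odf n \<ge> 1"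
  using odf_mono[of 0 n] by simp

text \<open>Log-convexity: raising \<open>i\<close> by one multiplies the left side by
  \<open>2 * real (Suc i + a) + 3\<close> and the right side by the larger
  \<open>2 * real (Suc (i + j) + a) + 3\<close>. Products with a fixed index sum therefore peak at
  the ends.\<close>

lemma odf_mult_le: "odf (Suc i + a) * odf (Suc j + a) \<le> odf (Suc a) * odf (Suc (i + j) + a)"
proof (induction i)
  case (Suc i)
  have "odf (Suc (Suc i) + a) * odf (Suc j + a)
      = (2 * real (Suc i + a) + 3) * (odf (Suc i + a) * odf (Suc j + a))"
    by (simp add: odf_Suc)
  also have "\<dots> \<le> (2 * real (Suc (i + j) + a) + 3) * (odf (Suc a) * odf (Suc (i + j) + a))"
    by (intro mult_mono Suc) auto
  also have "\<dots> = odf (Suc a) * odf (Suc (Suc i + j) + a)"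
    by (simp add: odf_Suc)
  finally show ?case .
qed simp

text \<open>The two end terms give \<open>2 * odf a * odf (n + a)\<close>. Each of the n - 1 inner
  terms is at most \<open>odf (Suc a) * odf (n - 1 + a)\<close>, and one step of the double
  factorial outgrows their number.\<close>

lemma odf_convolution_le:
  "(\<Sum>i\<le>n. odf (i + a) * odf (n - i + a)) \<le> (2 * odf a + odf (Suc a)) * odf (n + a)"
proof -
  consider "n = 0" | m where "n = Suc m" by (cases n) auto
  thus ?thesis
  proof cases
    case 1
    thus ?thesis by (simp add: distrib_right)
  next
    case 2
    have "(\<Sum>i\<le>n. odf (i + a) * odf (n - i + a))
        = 2 * odf a * odf (n + a) + (\<Sum>i<m. odf (Suc i + a) * odf (n - Suc i + a))"
      unfolding 2 by (subst sum.atMost_Suc, subst sum.atMost_shift) (simp add: algebra_simps)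
    also have "(\<Sum>i<m. odf (Suc i + a) * odf (n - Suc i + a))
        \<le> (\<Sum>i<m. odf (Suc a) * odf (m + a))"
    proof (intro sum_mono)
      fix i assume "i \<in> {..<m}"
      then obtain j where j: "m = Suc (i + j)" by (auto dest: less_imp_Suc_add)
      show "odf (Suc i + a) * odf (n - Suc i + a) \<le> odf (Suc a) * odf (m + a)"
        using odf_mult_le[of i a j] by (simp add: 2 j)
    qed
    also have "\<dots> = odf (Suc a) * (real m * odf (m + a))" by simp
    also have "\<dots> \<le> odf (Suc a) * odf (n + a)"
      unfolding 2 by (intro mult_left_mono) (auto simp: odf_Suc intro!: mult_right_mono)
    finally show ?thesis by (simp add: algebra_simps)
  qed
qed

text \<open>The index shift \<open>a\<close> records the loss under differentiation and under
  division by powers of x; for each fixed \<open>a\<close> the class is closed under sums, products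
  and inverses.\<close>

definition odf_bounded :: "nat \<Rightarrow> real fps \<Rightarrow> bool" where
  "odf_bounded a f \<longleftrightarrow> (\<exists>K. \<forall>n. \<bar>fps_nth f n\<bar> \<le> K * odf (n + a))"

lemma odf_boundedI: "(\<And>n. \<bar>fps_nth f n\<bar> \<le> K * odf (n + a)) \<Longrightarrow> odf_bounded a f"
  unfolding odf_bounded_def by blast

lemma odf_boundedE:
  assumes "odf_bounded a f"
  obtains K where "K > 0" "\<And>n. \<bar>fps_nth f n\<bar> \<le> K * odf (n + a)"
proof -
  from assms obtain K where K: "\<And>n. \<bar>fps_nth f n\<bar> \<le> K * odf (n + a)"
    unfolding odf_bounded_def by blast
  have "\<bar>fps_nth f n\<bar> \<le> (\<bar>K\<bar> + 1) * odf (n + a)" for n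
    by (rule order.trans[OF K]) (auto intro!: mult_right_mono)
  thus ?thesis using that[of "\<bar>K\<bar> + 1"] by simp
qed

lemma odf_bounded_of_finite:
  assumes "\<And>n. n \<ge> N \<Longrightarrow> \<bar>fps_nth f n\<bar> \<le> K * odf (n + a)"
  shows "odf_bounded a f"
proof (rule odf_boundedI)
  fix n
  define M where "M = \<bar>K\<bar> + (\<Sum>i<N. \<bar>fps_nth f i\<bar>)"
  show "\<bar>fps_nth f n\<bar> \<le> M * odf (n + a)"
  proof (cases "n < N")
    case True
    hence "\<bar>fps_nth f n\<bar> \<le> (\<Sum>i<N. \<bar>fps_nth f i\<bar>)"
      by (intro member_le_sum) auto
    also have "\<dots> \<le> M * 1" by (simp add: M_def)
    also have "\<dots> \<le> M * odf (n + a)"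
      by (intro mult_left_mono odf_ge_1) (auto simp: M_def intro!: add_nonneg_nonneg sum_nonneg)
    finally show ?thesis .
  next
    case False
    have "\<bar>K\<bar> \<le> M" unfolding M_def by (simp add: sum_nonneg)
    hence "K \<le> M" by linarith
    thus ?thesis using assms[of n] False
      by (smt (verit) mult_right_mono odf_nonneg not_less)
  qed
qed

lemma odf_bounded_1: "odf_bounded a 1"
  by (rule odf_bounded_of_finite[where N = 1 and K = 0]) auto

lemma odf_bounded_add:
  assumes "odf_bounded a f" "odf_bounded a g"
  shows "odf_bounded a (f + g)"
proof -
  from assms(1) obtain K where K: "\<And>n. \<bar>fps_nth f n\<bar> \<le> K * odf (n + a)"
    by (rule odf_boundedE) blast
  from assms(2) obtain L where L: "\<And>n. \<bar>fps_nth g n\<bar> \<le> L * odf (n + a)"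
    by (rule odf_boundedE) blast
  show ?thesis
  proof (rule odf_boundedI)
    fix n show "\<bar>fps_nth (f + g) n\<bar> \<le> (K + L) * odf (n + a)"
      using K[of n] L[of n] by (simp add: distrib_right)
  qed
qed

lemma odf_bounded_uminus: "odf_bounded a f \<Longrightarrow> odf_bounded a (-f)"
  by (simp add: odf_bounded_def)

lemma odf_bounded_diff: "odf_bounded a f \<Longrightarrow> odf_bounded a g \<Longrightarrow> odf_bounded a (f - g)"
  using odf_bounded_add[of a f "-g"] odf_bounded_uminus[of a g] by simp

lemma odf_bounded_mult:
  assumes "odf_bounded a f" "odf_bounded a g"
  shows "odf_bounded a (f * g)"
proof -
  from assms(1) obtain K where K: "K > 0" "\<And>n. \<bar>fps_nth f n\<bar> \<le> K * odf (n + a)"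
    by (rule odf_boundedE) blast
  from assms(2) obtain L where L: "L > 0" "\<And>n. \<bar>fps_nth g n\<bar> \<le> L * odf (n + a)"
    by (rule odf_boundedE) blast
  show ?thesis
  proof (rule odf_boundedI)
    fix n
    have "\<bar>fps_nth (f * g) n\<bar> \<le> (\<Sum>i\<le>n. \<bar>fps_nth f i\<bar> * \<bar>fps_nth g (n - i)\<bar>)"
      unfolding fps_mult_nth atLeast0AtMost abs_mult [symmetric] by (rule sum_abs)
    also have "\<dots> \<le> (\<Sum>i\<le>n. (K * odf (i + a)) * (L * odf (n - i + a)))"
      using K(1) L(1) by (intro sum_mono mult_mono K L) auto
    also have "\<dots> = K * L * (\<Sum>i\<le>n. odf (i + a) * odf (n - i + a))"
      by (simp add: sum_distrib_left mult_ac)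
    also have "\<dots> \<le> K * L * ((2 * odf a + odf (Suc a)) * odf (n + a))"
      using K L by (intro mult_left_mono odf_convolution_le) auto
    finally show "\<bar>fps_nth (f * g) n\<bar> \<le> (K * L * (2 * odf a + odf (Suc a))) * odf (n + a)"
      by (simp add: mult_ac)
  qed
qed

text \<open>The two extreme terms of the convolution dominate; the others only contribute
  \<open>odf (n - 1)\<close>, which is what makes the induction for the inverse close.\<close>

lemma odf_bounded_inverse:
  assumes "odf_bounded a f" "fps_nth f 0 \<noteq> 0"
  shows "odf_bounded a (inverse f)"
proof -
  define v where "v = inverse f"
  define d where "d = \<bar>fps_nth f 0\<bar>"
  have d: "d > 0" using assms(2) by (simp add: d_def)
  from assms(1) obtain A where A: "A > 0" "\<And>n. \<bar>fps_nth f n\<bar> \<le> A * odf (n + a)"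
    by (rule odf_boundedE) blast
  define B where "B = 2 * odf (Suc a) + odf (Suc (Suc a))"
  have B: "B > 0" by (simp add: B_def add_pos_pos)
  \<comment> \<open>Beyond \<open>N\<close> the inner convolution terms use at most half of the
    allowed bound; the second summand of \<open>M\<close> reserves the other half for the term with
    \<open>fps_nth v 0\<close>.\<close>
  obtain N where N: "real N \<ge> 2 * A * B / d" using real_arch_simple by blast
  define M where "M = (\<Sum>i\<le>N. \<bar>fps_nth v i\<bar>) + 2 * A * \<bar>fps_nth v 0\<bar> / d"
  have M0: "M \<ge> 0" unfolding M_def using A d by (intro add_nonneg_nonneg sum_nonneg) auto
  have "\<bar>fps_nth v n\<bar> \<le> M * odf (n + a)" for n
  proof (induction n rule: less_induct)
    case (less n)
    show ?case
    proof (cases "n \<le> Suc 0 \<or> n \<le> N")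
      case True
      show ?thesis
      proof (cases "n \<le> N")
        case True
        hence "\<bar>fps_nth v n\<bar> \<le> (\<Sum>i\<le>N. \<bar>fps_nth v i\<bar>)"
          by (intro member_le_sum) auto
        also have "\<dots> \<le> M * 1" using A d by (simp add: M_def)
        also have "\<dots> \<le> M * odf (n + a)" by (intro mult_left_mono odf_ge_1 M0)
        finally show ?thesis .
      next
        case False
        hence "N = 0" "n = 1" using True by auto
        with N have "A * B \<le> 0" using d by (simp add: divide_le_0_iff)
        with A B show ?thesis by (smt (verit) mult_pos_pos)
      qed
    next
      case False
      then obtain m where m: "n = Suc (Suc m)"
        by (metis One_nat_def le_0_eq not_less_eq_eq old.nat.exhaust)
      from False have nN: "real N \<le> real n" by simp
      have "0 = fps_nth (f * v) n"
        using assms(2) m by (simp add: v_def inverse_mult_eq_1')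
      also have "\<dots> = fps_nth f 0 * fps_nth v n + fps_nth f n * fps_nth v 0
          + (\<Sum>i\<le>m. fps_nth f (Suc i) * fps_nth v (n - Suc i))"
        unfolding fps_mult_nth atLeast0AtMost m
        by (subst sum.atMost_shift, subst lessThan_Suc_atMost [symmetric]) (simp add: lessThan_Suc_atMost)
      finally have "d * \<bar>fps_nth v n\<bar> = \<bar>fps_nth f n * fps_nth v 0
          + (\<Sum>i\<le>m. fps_nth f (Suc i) * fps_nth v (n - Suc i))\<bar>"
        unfolding d_def abs_mult [symmetric] by linarith
      also have "\<dots> \<le> \<bar>fps_nth f n\<bar> * \<bar>fps_nth v 0\<bar>
          + (\<Sum>i\<le>m. \<bar>fps_nth f (Suc i)\<bar> * \<bar>fps_nth v (n - Suc i)\<bar>)"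
        unfolding abs_mult [symmetric] by (intro order.trans[OF abs_triangle_ineq] add_mono sum_abs) auto
      also have "\<dots> \<le> A * odf (n + a) * \<bar>fps_nth v 0\<bar>
          + (\<Sum>i\<le>m. (A * odf (Suc i + a)) * (M * odf (n - Suc i + a)))"
        using A(1) M0 m by (intro add_mono sum_mono mult_mono less A(2) mult_right_mono) auto
      also have "(\<Sum>i\<le>m. (A * odf (Suc i + a)) * (M * odf (n - Suc i + a)))
          = A * M * (\<Sum>i\<le>m. odf (i + Suc a) * odf (m - i + Suc a))"
        by (auto simp: sum_distrib_left m mult_ac Suc_diff_le intro!: sum.cong)
      also have "\<dots> \<le> A * M * (B * odf (m + Suc a))"
        unfolding B_def using A M0 by (intro mult_left_mono odf_convolution_le) auto
      finally have "d * \<bar>fps_nth v n\<bar> \<le> A * odf (n + a) * \<bar>fps_nth v 0\<bar>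
          + M * (A * B * odf (m + Suc a))" by (simp add: mult_ac)
      also have "A * B * odf (m + Suc a) \<le> d / 2 * odf (n + a)"
      proof -
        have "A * B \<le> d / 2 * real N" using N d by (simp add: field_simps)
        also have "\<dots> \<le> d / 2 * (2 * real (m + Suc a) + 3)"
          using nN d by (intro mult_left_mono) (auto simp: m)
        finally have "A * B * odf (m + Suc a)
            \<le> d / 2 * (2 * real (m + Suc a) + 3) * odf (m + Suc a)"
          by (intro mult_right_mono) auto
        thus ?thesis using odf_Suc[of "m + Suc a"] by (simp add: m mult_ac)
      qed
      also have "A * odf (n + a) * \<bar>fps_nth v 0\<bar> = (A * \<bar>fps_nth v 0\<bar> / d) * d * odf (n + a)"
        using d by simp
      also have "A * \<bar>fps_nth v 0\<bar> / d \<le> M / 2"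
        unfolding M_def by (simp add: sum_nonneg mult_ac)
      finally have "d * \<bar>fps_nth v n\<bar> \<le> M / 2 * d * odf (n + a) + M * (d / 2 * odf (n + a))"
        using d M0 by (simp add: mult_left_mono mult_right_mono)
      also have "\<dots> = d * (M * odf (n + a))" by (simp add: field_simps)
      finally show ?thesis using d by simp
    qed
  qed
  thus ?thesis unfolding v_def by (rule odf_boundedI)
qed

lemma odf_bounded_X_mult: "odf_bounded a f \<Longrightarrow> odf_bounded a (fps_X * f)"
proof -
  have "odf_bounded a fps_X"
    by (rule odf_bounded_of_finite[where N = 2 and K = 0]) auto
  thus "odf_bounded a f \<Longrightarrow> odf_bounded a (fps_X * f)" by (rule odf_bounded_mult)
qed

lemma odf_bounded_deriv:
  assumes "odf_bounded a f"
  shows "odf_bounded (a + 2) (fps_deriv f)"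
proof -
  from assms obtain K where K: "K > 0" "\<And>n. \<bar>fps_nth f n\<bar> \<le> K * odf (n + a)"
    by (rule odf_boundedE) blast
  show ?thesis
  proof (rule odf_boundedI)
    fix n
    have "\<bar>fps_nth (fps_deriv f) n\<bar> = real (Suc n) * \<bar>fps_nth f (Suc n)\<bar>"
      by (simp add: abs_mult)
    also have "\<dots> \<le> real (Suc n) * (K * odf (Suc n + a))"
      by (intro mult_left_mono K) auto
    also have "\<dots> = K * (real (Suc n) * odf (Suc n + a))" by simp
    also have "\<dots> \<le> K * odf (n + (a + 2))"
      using K by (intro mult_left_mono) (auto simp: odf_Suc intro!: mult_right_mono)
    finally show "\<bar>fps_nth (fps_deriv f) n\<bar> \<le> K * odf (n + (a + 2))" .
  qed
qed

lemma odf_bounded_shift: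
  assumes "odf_bounded a f"
  shows "odf_bounded (a + m) (fps_shift m f)"
proof -
  from assms obtain K where "\<And>n. \<bar>fps_nth f n\<bar> \<le> K * odf (n + a)"
    by (rule odf_boundedE) blast
  from this[of "_ + m"] show ?thesis
    by (intro odf_boundedI[of _ K]) (simp add: add_ac)
qed

text \<open>The largest convolution term pairs index L + 1 with n - L - 1. Formally, x^(L+1) is
  split off both factors; this shifts each bound by L + 1 but the product by 2 (L + 1).\<close>

lemma odf_bounded_mult_high_order:
  assumes "odf_bounded 0 f" "odf_bounded 0 g"
    and "\<And>i. i \<le> L \<Longrightarrow> fps_nth f i = 0" "\<And>i. i \<le> L \<Longrightarrow> fps_nth g i = 0"
  shows "(\<lambda>n. fps_nth (f * g) n) \<in> O(\<lambda>n. odf (n - Suc L))"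
proof -
  define F where "F = fps_shift (Suc L) f"
  define G where "G = fps_shift (Suc L) g"
  have f: "f = fps_X ^ Suc L * F" and g: "g = fps_X ^ Suc L * G"
    using assms(3,4) by (auto simp: F_def G_def fps_eq_iff fps_X_power_mult_nth simp del: power_Suc)
  have "odf_bounded (Suc L) (F * G)"
    using odf_bounded_shift[OF assms(1), of "Suc L"] odf_bounded_shift[OF assms(2), of "Suc L"]
    by (auto intro!: odf_bounded_mult simp: F_def G_def)
  then obtain K where K: "K > 0" "\<And>n. \<bar>fps_nth (F * G) n\<bar> \<le> K * odf (n + Suc L)"
    by (rule odf_boundedE) blast
  have fg: "f * g = fps_X ^ (Suc L + Suc L) * (F * G)"
    by (simp only: f g power_add mult_ac)
  show ?thesis
  proof (rule bigoI[where c = K])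
    show "\<forall>\<^sub>F n in at_top. norm (fps_nth (f * g) n) \<le> K * norm (odf (n - Suc L))"
      using eventually_ge_at_top[of "Suc L + Suc L"]
    proof eventually_elim
      case (elim n)
      then obtain m where m: "n = Suc L + Suc L + m" using le_Suc_ex by blast
      have "fps_nth (f * g) n = fps_nth (F * G) m"
        unfolding fg by (simp only: fps_X_power_mult_nth m) simp
      with K(2)[of m] show ?case by (simp add: m add_ac)
    qed
  qed
qed

section \<open>The renormalized series and its differential equation\<close>


definition kappa :: "real fps" where
  "kappa = Abs_fps odf"

lemma kappa_nth [simp]: "fps_nth kappa n = odf n"
  by (simp add: kappa_def)

lemma chi_eq: "chi = 1 + fps_X * kappa"
proof (rule fps_ext)
  fix n show "fps_nth chi n = fps_nth (1 + fps_X * kappa) n"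
    by (cases n) (simp_all add: chi_def odf_def)
qed

lemma kappa_ode: "kappa = 1 + 3 * fps_X * kappa + 2 * fps_X ^ 2 * fps_deriv kappa"
proof -
  have "kappa = 1 + fps_X * (fps_const 3 * kappa + fps_const 2 * (fps_X * fps_deriv kappa))"
    unfolding fps_mult_fps_X_deriv_shift
  proof (rule fps_ext)
    fix n
    show "fps_nth kappa n = fps_nth (1 + fps_X * (fps_const 3 * kappa
      + fps_const 2 * Abs_fps (\<lambda>n. of_nat n * fps_nth kappa n))) n"
      by (cases n) (simp_all add: odf_Suc algebra_simps)
  qed
  thus ?thesis by (simp add: numeral_fps_const algebra_simps power2_eq_square)
qed

lemma chi_deriv: "2 * fps_X * fps_deriv chi = kappa - chi"
proof -
  have "fps_X * (fps_const 2 * fps_deriv chi) = kappa - chi"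
  proof (rule fps_ext)
    fix n show "fps_nth (fps_X * (fps_const 2 * fps_deriv chi)) n = fps_nth (kappa - chi) n"
      by (cases n) (simp_all add: chi_eq odf_Suc algebra_simps)
  qed
  thus ?thesis by (simp add: numeral_fps_const mult_ac)
qed

lemma chi_inverse: "chi * inverse chi = (1 :: real fps)"
  by (rule inverse_mult_eq_1') simp

lemma kappa_inverse: "kappa * inverse kappa = 1"
  by (rule inverse_mult_eq_1') simp

text \<open>\<open>ev0\<close> and \<open>dv0\<close> are the value and the first derivative at \<open>\<phi> = 0\<close>.\<close>

definition ev0 :: "real fps fps \<Rightarrow> real fps" where
  "ev0 f = Abs_fps (\<lambda>n. fps_nth (fps_nth f n) 0)"

definition dv0 :: "real fps fps \<Rightarrow> real fps" where
  "dv0 f = Abs_fps (\<lambda>n. fps_nth (fps_nth f n) 1)"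

lemma ev0_mult: "ev0 (f * g) = ev0 f * ev0 g"
  by (simp add: fps_eq_iff ev0_def fps_mult_nth fps_sum_nth)

lemma dv0_mult: "dv0 (f * g) = dv0 f * ev0 g + ev0 f * dv0 g"
  by (simp add: fps_eq_iff ev0_def dv0_def fps_mult_nth fps_sum_nth sum.distrib add.commute)

lemma ev0_1: "ev0 1 = 1" and dv0_1: "dv0 1 = 0"
  by (auto simp: fps_eq_iff ev0_def dv0_def)

lemma fps_power_nth_1: "fps_nth f 0 = 1 \<Longrightarrow> fps_nth (f ^ n) (Suc 0) = of_nat n * fps_nth f (Suc 0)"
  for f :: "'a :: comm_ring_1 fps"
  by (induction n) (simp_all add: fps_mult_nth_1 fps_nth_power_0 algebra_simps)

lemma fps_compose_X_mult_const_nth: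
  "fps_nth (f oo (fps_X * fps_const c)) n = fps_nth f n * c ^ n"
  for f :: "'a :: comm_ring_1 fps"
proof -
  have "(fps_X * fps_const c) ^ i = fps_X ^ i * fps_const (c ^ i)" for i
    by (simp add: power_mult_distrib fps_const_power)
  hence "fps_nth (f oo (fps_X * fps_const c)) n = (\<Sum>i=0..n. if i = n then fps_nth f n * c ^ n else 0)"
    unfolding fps_compose_nth
    by (intro sum.cong) (auto simp: fps_X_power_mult_nth)
  thus ?thesis by simp
qed

text \<open>Since 1 / (1 - \<phi>)^2 = 1 + 2 \<phi> + ..., the \<phi>-derivative of the composed
  \<open>chi\<close> at 0 is 2 x chi' = kappa - chi. The Leibniz rule applied to
  \<open>B * I = 1\<close> and to \<open>G2\<close> gives the rest.\<close>

lemma G_eq: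
  shows "G_psi_psibar = - inverse chi"
    and "G_phi_psi_psibar = kappa * inverse chi ^ 2"
proof -
  define q :: "real fps" where "q = inverse ((1 - fps_X) ^ 2)"
  define B where "B = chi oo (fps_X * fps_const q)"
  define I where "I = inverse B"
  have q0: "fps_nth q 0 = 1" by (simp add: q_def power2_eq_square)
  have "q * (1 - fps_X) ^ 2 = 1" unfolding q_def by (rule inverse_mult_eq_1) (simp add: power2_eq_square)
  hence "fps_nth (q * (1 - fps_X) ^ 2) 1 = 0" by simp
  hence q1: "fps_nth q (Suc 0) = 2"
    by (simp add: fps_mult_nth_1 q0 power2_eq_square)
  have evB: "ev0 B = chi"
    by (simp add: fps_eq_iff ev0_def B_def fps_compose_X_mult_const_nth chi_def q0
        fps_nth_power_0 fps_of_nat [symmetric])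
  have dvB: "dv0 B = kappa - chi"
  proof -
    have "dv0 B = fps_X * (fps_const 2 * fps_deriv chi)"
    proof (rule fps_ext)
      fix n
      show "fps_nth (dv0 B) n = fps_nth (fps_X * (fps_const 2 * fps_deriv chi)) n"
        by (cases n) (simp_all add: dv0_def B_def fps_compose_X_mult_const_nth chi_def q0 q1
          fps_of_nat [symmetric] fps_power_nth_1 del: of_nat_Suc power_Suc)
    qed
    also have "\<dots> = 2 * fps_X * fps_deriv chi" by (simp add: numeral_fps_const mult_ac)
    finally have "dv0 B = 2 * fps_X * fps_deriv chi" .
    thus ?thesis by (simp add: chi_deriv)
  qed
  \<comment> \<open>The coefficients of \<open>B\<close> are themselves power series and form no
    field; the inverse exists because the constant coefficient is 1.\<close>
  have BI: "B * I = 1"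
    unfolding I_def
    by (subst fps_inverse_def, rule fps_right_inverse) (simp add: B_def chi_compose_nth_0)
  have "chi * ev0 I = 1" using ev0_mult[of B I] by (simp add: BI ev0_1 evB)
  hence evI: "ev0 I = inverse chi"
    by (metis fps_inverse_unique)
  have "0 = dv0 B * ev0 I + ev0 B * dv0 I"
    using dv0_mult[of B I] by (simp add: BI dv0_1)
  hence dvI: "dv0 I = - (kappa - chi) * inverse chi ^ 2"
    using chi_inverse unfolding dvB evB evI by algebra
  have G2: "G2 = fps_const (fps_X - 1) * I"
    by (simp add: G2_def I_def B_def q_def)
  have c: "ev0 (fps_const (fps_X - 1)) = -1" "dv0 (fps_const (fps_X - 1)) = 1"
    by (auto simp: fps_eq_iff ev0_def dv0_def fps_const_def)
  have "G_psi_psibar = ev0 G2" by (simp add: G_psi_psibar_def ev0_def)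
  thus "G_psi_psibar = - inverse chi"
    by (simp add: G2 ev0_mult c evI)
  have "G_phi_psi_psibar = dv0 G2" by (simp add: G_phi_psi_psibar_def dv0_def)
  also have "\<dots> = inverse chi + (kappa - chi) * inverse chi ^ 2"
    by (simp add: G2 dv0_mult c evI dvI algebra_simps)
  also have "\<dots> = kappa * inverse chi ^ 2"
    using chi_inverse by algebra
  finally show "G_phi_psi_psibar = kappa * inverse chi ^ 2" .
qed

text \<open>The invariant charge before squaring,
  \<open>G_phi_psi_psibar / (- G_psi_psibar)\<close>.\<close>

definition tau :: "real fps" where
  "tau = kappa * inverse chi"

lemma tau_nth_0 [simp]: "fps_nth tau 0 = 1"
  by (simp add: tau_def)

lemma chi_tau: "chi * (1 - fps_X * tau) = 1"
  using chi_inverse chi_eq unfolding tau_def by algebra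

text \<open>Differentiate kappa = chi tau and eliminate both derivatives by \<open>chi_deriv\<close>
  and \<open>kappa_ode\<close>. The common factor \<open>chi\<close> then cancels, its inverse being
  1 - x tau.\<close>

lemma tau_ode: "tau = 1 + fps_X * tau + fps_X * tau ^ 2 + 2 * fps_X ^ 2 * fps_deriv tau"
proof -
  have k: "kappa = chi * tau" using chi_inverse unfolding tau_def by algebra
  have "fps_deriv kappa = fps_deriv chi * tau + chi * fps_deriv tau"
    unfolding k by (simp add: mult_ac)
  with chi_deriv kappa_ode k chi_tau show ?thesis by algebra
qed

lemma alpha_eq: "alpha = tau ^ 2"
proof -
  have "alpha = (kappa * inverse chi ^ 2 * inverse (inverse chi)) ^ 2"
    by (simp add: alpha_def G_eq fps_divide_unit)
  also have "inverse (inverse chi) = (chi :: real fps)"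
    by (rule fps_inverse_idempotent) simp
  finally show ?thesis using chi_inverse unfolding tau_def by algebra
qed

lemma tau_nth_Suc:
  "fps_nth tau (Suc n) = fps_nth tau n + fps_nth (tau ^ 2) n + 2 * real n * fps_nth tau n"
proof -
  have "tau = 1 + fps_X * (tau + tau ^ 2 + fps_const 2 * (fps_X * fps_deriv tau))"
    by (subst tau_ode) (simp add: numeral_fps_const algebra_simps power2_eq_square)
  hence "fps_nth tau (Suc n)
      = fps_nth (1 + fps_X * (tau + tau ^ 2 + fps_const 2 * (fps_X * fps_deriv tau))) (Suc n)"
    by simp
  thus ?thesis unfolding fps_mult_fps_X_deriv_shift by simp
qed

lemma fps_mult_nth_nonneg:
  fixes f g :: "real fps"
  assumes "\<And>i. i \<le> n \<Longrightarrow> fps_nth f i \<ge> 0" "\<And>i. i \<le> n \<Longrightarrow> fps_nth g i \<ge> 0"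
  shows "fps_nth (f * g) n \<ge> 0"
  unfolding fps_mult_nth using assms by (intro sum_nonneg mult_nonneg_nonneg) auto

text \<open>The Riccati equation yields a coefficient recurrence with plus signs only. All powers of
  \<open>alpha\<close> inherit the sign, which the termwise comparisons for y o a rely on.\<close>

lemma tau_nonneg: "fps_nth tau n \<ge> 0"
proof (induction n rule: less_induct)
  case (less n)
  show ?case
  proof (cases n)
    case (Suc m)
    have "fps_nth (tau ^ 2) m \<ge> 0"
      unfolding power2_eq_square by (rule fps_mult_nth_nonneg) (auto intro!: less simp: Suc)
    moreover have "fps_nth tau m \<ge> 0" by (rule less) (auto simp: Suc)
    ultimately show ?thesis unfolding Suc tau_nth_Suc by (intro add_nonneg_nonneg mult_nonneg_nonneg) auto
  qed simp
qed

lemma alpha_nonneg: "fps_nth alpha n \<ge> 0"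
  unfolding alpha_eq power2_eq_square by (intro fps_mult_nth_nonneg tau_nonneg)

lemma alpha_power_nonneg: "fps_nth (alpha ^ k) n \<ge> 0"
proof (induction k arbitrary: n)
  case (Suc k)
  thus ?case by (auto intro!: fps_mult_nth_nonneg alpha_nonneg)
qed simp

lemma alpha_nth_1: "fps_nth alpha 1 = 4"
  using tau_nth_Suc[of 0] by (simp add: alpha_eq power2_eq_square fps_mult_nth_1)

section \<open>Passing between the bare and the renormalized variable\<close>

definition avar :: "real fps" where "avar = fps_X * alpha"

lemma avar_nth_0 [simp]: "fps_nth avar 0 = 0"
  by (simp add: avar_def)

lemma hbar: "fps_nth hbar 0 = 0" "avar oo hbar = fps_X" "hbar oo avar = fps_X"
proof -
  have h: "is_hbar hbar" unfolding hbar_def by (rule theI'[OF ex1_is_hbar])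
  thus 0: "fps_nth hbar 0 = 0" by (simp add: is_hbar_def)
  with h show 1: "avar oo hbar = fps_X"
    by (simp add: is_hbar_def avar_def fps_compose_mult_distrib)
  have a1: "fps_nth avar 1 \<noteq> 0" by (simp add: avar_def alpha_nth_0)
  have "fps_inv avar oo avar = fps_X" by (rule fps_inv) (use a1 in auto)
  moreover have "hbar = (fps_inv avar oo avar) oo hbar"
    by (subst fps_inv) (use a1 0 in auto)
  hence "hbar = fps_inv avar"
    using 1 0 by (subst (asm) fps_compose_assoc [symmetric]) auto
  ultimately show "hbar oo avar = fps_X" by simp
qed

text \<open>Identities for \<open>yser\<close> are verified after substituting \<open>avar\<close>,
  where everything becomes an expression in \<open>tau\<close>; composing with \<open>hbar\<close>
  undoes the substitution.\<close>

lemma compose_avar_inject: "f oo avar = g oo avar \<Longrightarrow> f = g"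
proof -
  assume "f oo avar = g oo avar"
  hence "(f oo avar) oo hbar = (g oo avar) oo hbar" by simp
  thus "f = g"
    using hbar by (simp add: fps_compose_assoc [symmetric])
qed

definition yser :: "real fps" where "yser = 1 - z_vertex"

definition Yser :: "real fps" where "Yser = 1 - chi ^ 2 * inverse kappa"

lemma yser_compose: "yser oo avar = Yser"
proof -
  have 1: "fps_nth (G_phi_psi_psibar) 0 = 1" by (simp add: G_eq fps_nth_power_0)
  have "z_vertex = inverse G_phi_psi_psibar oo hbar"
    using 1 hbar by (simp add: z_vertex_def fps_divide_unit fps_inverse_compose)
  hence "z_vertex oo avar = inverse G_phi_psi_psibar oo (hbar oo avar)"
    using fps_compose_assoc[of avar hbar "inverse G_phi_psi_psibar"] hbar(1) by simp
  also have "\<dots> = inverse G_phi_psi_psibar" by (simp add: hbar)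
  also have "\<dots> = chi ^ 2 * inverse kappa"
    by (simp add: G_eq fps_inverse_mult fps_inverse_power)
  finally show ?thesis
    by (simp add: yser_def Yser_def fps_compose_sub_distrib)
qed

lemma fps_deriv_compose_avar: "(fps_deriv yser oo avar) * fps_deriv avar = fps_deriv Yser"
  by (simp add: fps_compose_deriv flip: yser_compose)

lemma yser_ode: "2 * fps_X * yser * fps_deriv yser = (1 - yser) * (yser - fps_X * (1 - yser))"
proof (rule compose_avar_inject)
  define g where "g = tau * (1 - fps_X * tau)"
  define E where "E = fps_deriv yser oo avar"
  have k: "kappa = chi * tau" using chi_inverse unfolding tau_def by algebra
  have Yg: "(1 - Yser) * g = 1"
    using chi_tau kappa_inverse k unfolding Yser_def g_def by algebra
  have "fps_deriv ((1 - Yser) * g) = 0" by (simp add: Yg)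
  hence Yg': "fps_deriv Yser * g = (1 - Yser) * fps_deriv g" by (simp add: algebra_simps)
  have g': "fps_deriv g = fps_deriv tau * (1 - 2 * fps_X * tau) - tau ^ 2"
    unfolding g_def by (simp add: algebra_simps power2_eq_square)
  have a: "avar = fps_X * tau ^ 2" by (simp add: avar_def alpha_eq)
  have a': "fps_deriv avar = tau * (tau + 2 * fps_X * fps_deriv tau)"
    unfolding a by (simp add: algebra_simps power2_eq_square)
  \<comment> \<open>The elimination closes because the Riccati equation turns x a' and 2 x^2 g' into
    polynomials in x and tau, with factors g - 1 and g - 1 - a. Hence \<open>P\<close> and
    \<open>Q\<close> agree after multiplication by x a' g^3, which cancels in an integral
    domain.\<close>
  have aX: "fps_X * fps_deriv avar = tau * (g - 1)"
    using tau_ode unfolding a' g_def by algebra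
  have gX: "2 * fps_X ^ 2 * fps_deriv g = (1 - fps_X * tau) * (tau - 1 - 2 * fps_X * tau ^ 2)"
    using tau_ode unfolding g' by algebra
  have EY: "E * fps_deriv avar = fps_deriv Yser"
    unfolding E_def by (rule fps_deriv_compose_avar)
  define P where "P = 2 * avar * Yser * E"
  define Q where "Q = (1 - Yser) * (Yser - avar * (1 - Yser))"
  have Y1: "Yser * g = g - 1" using Yg by (simp add: algebra_simps)
  have Y2: "fps_deriv Yser * g ^ 2 = fps_deriv g" using Yg Yg' by algebra
  have P: "P * fps_deriv avar * g ^ 3 = 2 * avar * (g - 1) * fps_deriv g"
    using Y1 Y2 EY unfolding P_def by algebra
  have Q1: "Q * g ^ 2 = g - 1 - avar" using Yg Y1 unfolding Q_def by algebra
  have "fps_X * (P * fps_deriv avar * g ^ 3) = tau ^ 2 * (g - 1) * (2 * fps_X ^ 2 * fps_deriv g)"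
    unfolding P unfolding a by algebra
  also have "\<dots> = (tau * (g - 1)) * g * (g - 1 - avar)"
    unfolding gX unfolding a g_def by algebra
  also have "\<dots> = fps_X * (Q * fps_deriv avar * g ^ 3)"
    unfolding aX [symmetric] Q1 [symmetric] by algebra
  finally have "P * (fps_deriv avar * g ^ 3) = Q * (fps_deriv avar * g ^ 3)"
    by (simp add: mult.assoc)
  moreover have "fps_nth (fps_deriv avar) 0 \<noteq> 0"
    by (simp add: avar_def alpha_nth_0)
  hence "fps_deriv avar \<noteq> 0" by fastforce
  moreover have "g \<noteq> 0" using Yg by auto
  ultimately have "P = Q" by simp
  thus "(2 * fps_X * yser * fps_deriv yser) oo avar
      = ((1 - yser) * (yser - fps_X * (1 - yser))) oo avar"
    by (simp add: P_def Q_def E_def fps_compose_mult_distrib fps_compose_sub_distrib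
        yser_compose mult_ac numeral_fps_const)
qed

section \<open>Coefficient bounds\<close>


lemma compose_avar_nth:
  "fps_nth (f oo avar) m = (\<Sum>j\<le>m. fps_nth f (m - j) * fps_nth (alpha ^ (m - j)) j)"
proof -
  have "fps_nth (f oo avar) m = (\<Sum>i\<le>m. fps_nth f i * fps_nth (alpha ^ i) (m - i))"
    unfolding fps_compose_nth atLeast0AtMost
    by (intro sum.cong) (auto simp: avar_def power_mult_distrib fps_X_power_mult_nth)
  also have "\<dots> = (\<Sum>j\<le>m. fps_nth f (m - j) * fps_nth (alpha ^ (m - j)) j)"
    by (rule sum.reindex_bij_witness[of _ "\<lambda>j. m - j" "\<lambda>j. m - j"]) auto
  finally show ?thesis .
qed

lemma yser_nth_0 [simp]: "fps_nth yser 0 = 0"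
proof -
  have "fps_nth yser 0 = fps_nth (yser oo avar) 0" by simp
  also have "\<dots> = 0" unfolding yser_compose by (simp add: Yser_def fps_nth_power_0)
  finally show ?thesis .
qed

text \<open>Writing 2 y y' as the derivative of y^2 makes coefficient extraction a recurrence: y has
  no constant term, so the coefficient of y^2 at n + 1 involves y_1, ..., y_n only. The lone
  \<open>fps_X\<close> affects coefficient 1 alone.\<close>

lemma yser_square: "fps_X * fps_deriv (yser ^ 2) + fps_X
    = yser + fps_const 2 * (fps_X * yser) - yser ^ 2 - fps_X * yser ^ 2"
proof -
  have "fps_deriv (yser ^ 2) = 2 * yser * fps_deriv yser"
    by (simp add: power2_eq_square)
  thus ?thesis using yser_ode unfolding numeral_fps_const [symmetric] by algebra
qed

lemma yser_nth_1 [simp]: "fps_nth yser (Suc 0) = 1"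
proof -
  have "fps_nth (fps_X * fps_deriv (yser ^ 2) + fps_X) (Suc 0)
      = fps_nth (yser + fps_const 2 * (fps_X * yser) - yser ^ 2 - fps_X * yser ^ 2) (Suc 0)"
    by (simp only: yser_square)
  thus ?thesis by (simp add: power2_eq_square fps_mult_nth_1)
qed

lemma yser_rec:
  assumes "n \<ge> 1"
  shows "fps_nth yser (Suc n)
      = (real n + 2) * fps_nth (yser ^ 2) (Suc n) + fps_nth (yser ^ 2) n - 2 * fps_nth yser n"
proof -
  have "fps_nth (fps_X * fps_deriv (yser ^ 2) + fps_X) (Suc n)
      = fps_nth (yser + fps_const 2 * (fps_X * yser) - yser ^ 2 - fps_X * yser ^ 2) (Suc n)"
    by (simp only: yser_square)
  thus ?thesis using assms by (simp add: algebra_simps)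
qed

lemma yser_nths:
  shows yser_nth_2: "fps_nth yser 2 = 1" and yser_nth_3: "fps_nth yser 3 = 7"
    and yser_nth_4: "fps_nth yser 4 = 63" and yser_nth_5: "fps_nth yser 5 = 729"
proof -
  note s = power2_eq_square[of yser] fps_mult_nth numeral_eq_Suc
  show 2: "fps_nth yser 2 = 1" using yser_rec[of 1] by (simp add: s)
  show 3: "fps_nth yser 3 = 7" using yser_rec[of 2] 2 by (simp add: s)
  show 4: "fps_nth yser 4 = 63" using yser_rec[of 3] 2 3 by (simp add: s)
  show 5: "fps_nth yser 5 = 729" using yser_rec[of 4] 2 3 4 by (simp add: s)
qed

text \<open>The only negative contribution to the recurrence, -2 y_n, is absorbed by the term y_1
  y_n of the square, whose prefactor n + 2 is at least 2.\<close>

lemma yser_nonneg: "fps_nth yser n \<ge> 0"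
proof (induction n rule: less_induct)
  case (less n)
  consider "n = 0" | "n = 1" | m where "n = Suc m" "m \<ge> 1" by (cases n; cases "n - 1") auto
  thus ?case
  proof cases
    case 3
    have pos: "fps_nth yser i * fps_nth yser (k - i) \<ge> 0" if "i \<le> k" "k \<le> Suc m" for i k
    proof (cases "i = 0 \<or> i = k")
      case False
      thus ?thesis using that by (intro mult_nonneg_nonneg less) (auto simp: 3)
    qed auto
    have "fps_nth yser 1 * fps_nth yser (Suc m - 1) \<le> fps_nth (yser ^ 2) (Suc m)"
      unfolding power2_eq_square fps_mult_nth
      by (rule member_le_sum[where f = "\<lambda>i. fps_nth yser i * fps_nth yser (Suc m - i)"])
        (use pos in auto)
    hence p: "fps_nth yser m \<le> fps_nth (yser ^ 2) (Suc m)" by simp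
    have q: "0 \<le> fps_nth (yser ^ 2) m"
      unfolding power2_eq_square fps_mult_nth by (intro sum_nonneg pos) auto
    have y: "0 \<le> fps_nth yser m" by (rule less) (simp add: 3)
    have "2 * fps_nth yser m \<le> (real m + 2) * fps_nth (yser ^ 2) (Suc m)"
      using p y by (intro mult_mono) auto
    thus ?thesis using q yser_rec[OF 3(2)] by (simp add: 3)
  qed auto
qed

lemma odf_bounded_kappa: "odf_bounded 0 kappa"
  by (rule odf_boundedI[where K = 1]) simp

lemma odf_bounded_chi: "odf_bounded 0 chi"
  unfolding chi_eq by (intro odf_bounded_add odf_bounded_1 odf_bounded_X_mult odf_bounded_kappa)

lemma odf_bounded_alpha: "odf_bounded 0 alpha"
  unfolding alpha_eq tau_def power2_eq_square
  by (intro odf_bounded_mult odf_bounded_inverse odf_bounded_kappa odf_bounded_chi) auto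

lemma odf_bounded_Yser: "odf_bounded 0 Yser"
  unfolding Yser_def power2_eq_square
  by (intro odf_bounded_diff odf_bounded_1 odf_bounded_mult odf_bounded_inverse
      odf_bounded_kappa odf_bounded_chi) auto

definition yterm :: "nat \<Rightarrow> nat \<Rightarrow> real" where
  "yterm m j = fps_nth yser (m - j) * fps_nth (alpha ^ (m - j)) j"

lemma yterm_nonneg: "yterm m j \<ge> 0"
  unfolding yterm_def by (intro mult_nonneg_nonneg yser_nonneg alpha_power_nonneg)

lemma Yser_nth: "fps_nth Yser m = (\<Sum>j\<le>m. yterm m j)"
  unfolding yser_compose [symmetric] compose_avar_nth yterm_def ..

text \<open>By nonnegativity y_n, the j = 0 term, cannot exceed the whole sum
  \<open>Yser_nth\<close>, and \<open>Yser\<close> is built from \<open>chi\<close> and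
  \<open>kappa\<close> by bounded operations.\<close>

lemma odf_bounded_yser: "odf_bounded 0 yser"
proof -
  obtain K where K: "\<And>n. \<bar>fps_nth Yser n\<bar> \<le> K * odf (n + 0)"
    using odf_bounded_Yser by (rule odf_boundedE) blast
  show ?thesis
  proof (rule odf_boundedI)
    fix n
    have "fps_nth yser n = yterm n 0"
      by (simp add: yterm_def fps_nth_power_0 alpha_nth_0)
    also have "\<dots> \<le> fps_nth Yser n"
      unfolding Yser_nth by (rule member_le_sum) (auto simp: yterm_nonneg)
    finally show "\<bar>fps_nth yser n\<bar> \<le> K * odf (n + 0)"
      using K[of n] yser_nonneg[of n] by simp
  qed
qed

text \<open>With weights \<open>yterm m j\<close>, this bounds the mean of \<open>j\<close>; by Markov's inequality the sum in
  \<open>Yser_nth\<close> is then concentrated on bounded \<open>j\<close>, uniformly in \<open>m\<close>. The weighted sum is the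
  coefficient of \<open>\<hbar> Y' - a y'(a) = \<hbar>\<^sup>2 \<alpha>' y'(a)\<close>, where \<open>a = \<hbar> \<alpha>\<close>.\<close>

lemma yterm_mean_bounded:
  obtains K where "K > 0" "\<And>m. (\<Sum>j\<le>m. real j * yterm m j) \<le> K * odf m"
proof -
  define E where "E = fps_deriv yser oo avar"
  define T where "T = fps_X * fps_deriv Yser - (fps_X * fps_deriv yser oo avar)"
  have a0: "fps_nth (fps_deriv avar) 0 = 1" by (simp add: avar_def alpha_nth_0)
  have EY: "E * fps_deriv avar = fps_deriv Yser"
    unfolding E_def by (rule fps_deriv_compose_avar)
  have "fps_deriv avar * inverse (fps_deriv avar) = 1"
    by (rule inverse_mult_eq_1') (use a0 in linarith)
  \<comment> \<open>Dividing the chain rule by a' expresses y' o a through series already known to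
    be bounded, so no composition has to be estimated.\<close>
  with EY have E: "E = fps_deriv Yser * inverse (fps_deriv avar)"
    by (metis mult.assoc mult_1_right)
  have "odf_bounded 2 E"
    unfolding E using a0 odf_bounded_deriv[OF odf_bounded_Yser]
      odf_bounded_deriv[OF odf_bounded_X_mult[OF odf_bounded_alpha], folded avar_def]
    by (intro odf_bounded_mult odf_bounded_inverse) (auto simp: numeral_2_eq_2)
  hence "odf_bounded 2 (fps_deriv alpha * E)"
    using odf_bounded_deriv[OF odf_bounded_alpha]
    by (intro odf_bounded_mult) (auto simp: numeral_2_eq_2)
  then obtain K where K: "K > 0" "\<And>n. \<bar>fps_nth (fps_deriv alpha * E) n\<bar> \<le> K * odf (n + 2)"
    by (rule odf_boundedE) blast
  have "T = fps_X * (E * fps_deriv avar) - avar * E"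
    by (simp add: T_def EY fps_compose_mult_distrib flip: E_def)
  \<comment> \<open>Here x a' - a = x^2 alpha'. The factor x^2 exactly offsets the shift 2 caused by
    differentiation, so the final bound is a multiple of \<open>odf m\<close>.\<close>
  also have "\<dots> = fps_X ^ 2 * (fps_deriv alpha * E)"
    by (simp add: avar_def algebra_simps power2_eq_square)
  finally have T: "T = fps_X ^ 2 * (fps_deriv alpha * E)" .
  have "(\<Sum>j\<le>m. real j * yterm m j) \<le> K * odf m" for m
  proof -
    have "fps_nth T m = (\<Sum>j\<le>m. real m * yterm m j) - (\<Sum>j\<le>m. real (m - j) * yterm m j)"
      by (simp add: T_def compose_avar_nth fps_mult_fps_X_deriv_shift Yser_nth sum_distrib_left
          yterm_def mult_ac)
    also have "\<dots> = (\<Sum>j\<le>m. real j * yterm m j)"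
      unfolding sum_subtractf [symmetric]
      by (intro sum.cong) (auto simp: of_nat_diff algebra_simps)
    finally have "(\<Sum>j\<le>m. real j * yterm m j) = fps_nth T m" ..
    also have "\<dots> \<le> K * odf m"
    proof (cases "m < 2")
      case True
      thus ?thesis using K(1) by (simp add: T fps_X_power_mult_nth)
    next
      case False
      then obtain k where "m = k + 2" by (metis le_add_diff_inverse2 not_less)
      thus ?thesis using K(2)[of k] by (simp add: T fps_X_power_mult_nth)
    qed
    finally show ?thesis .
  qed
  with K(1) show ?thesis by (rule that)
qed

section \<open>Limits of coefficients relative to (2n+1)!!\<close>

lemma odf_pred_ratio: "(\<lambda>n. odf (n - 1) / odf n) \<longlonglongrightarrow> 0"
proof -
  have "(\<lambda>n. 1 / (2 * real n + 3)) \<longlonglongrightarrow> 0"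
    by (rule tendsto_sandwich[OF _ _ tendsto_const LIMSEQ_inverse_real_of_nat])
      (auto intro!: always_eventually simp: field_simps)
  also have "(\<lambda>n. 1 / (2 * real n + 3)) = (\<lambda>n. odf (Suc n - 1) / odf (Suc n))"
    by (simp add: odf_Suc fun_eq_iff)
  finally show ?thesis by (rule LIMSEQ_imp_Suc)
qed

lemma bigo_odf_pred_limit:
  assumes "f \<in> O(\<lambda>n. odf (n - 1))"
  shows "(\<lambda>n. f n / odf n) \<longlonglongrightarrow> 0"
proof -
  have "(\<lambda>n. odf (n - 1)) \<in> o(odf)"
    using odf_pred_ratio by (intro smalloI_tendsto) auto
  with assms have "f \<in> o(odf)" by (rule landau_o.big_small_trans)
  thus ?thesis by (rule smalloD_tendsto)
qed

text \<open>To leading order, taking the limit ratio is a derivation: after splitting off the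
  constant terms, the product of the remainders is of order \<open>odf (n - 1)\<close> and
  disappears in the limit.\<close>

lemma odf_mult_limit:
  assumes f: "odf_bounded 0 f" "(\<lambda>n. fps_nth f n / odf n) \<longlonglongrightarrow> A"
    and g: "odf_bounded 0 g" "(\<lambda>n. fps_nth g n / odf n) \<longlonglongrightarrow> B"
  shows "(\<lambda>n. fps_nth (f * g) n / odf n) \<longlonglongrightarrow> fps_nth f 0 * B + fps_nth g 0 * A"
proof -
  define f' where "f' = f - fps_const (fps_nth f 0)"
  define g' where "g' = g - fps_const (fps_nth g 0)"
  have c: "odf_bounded 0 (fps_const c)" for c
    by (rule odf_bounded_of_finite[where N = 1 and K = 0]) auto
  have "(\<lambda>n. fps_nth (f' * g') n) \<in> O(\<lambda>n. odf (n - Suc 0))"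
    by (rule odf_bounded_mult_high_order)
      (auto simp: f'_def g'_def intro!: odf_bounded_diff f g c)
  hence "(\<lambda>n. fps_nth (f' * g') n / odf n) \<longlonglongrightarrow> 0"
    by (intro bigo_odf_pred_limit) simp
  hence "(\<lambda>n. fps_nth (f' * g') n / odf n + fps_nth f 0 * (fps_nth g n / odf n)
      + fps_nth g 0 * (fps_nth f n / odf n)) \<longlonglongrightarrow> 0 + fps_nth f 0 * B + fps_nth g 0 * A"
    by (intro tendsto_intros f g)
  moreover have "eventually (\<lambda>n. fps_nth (f' * g') n / odf n + fps_nth f 0 * (fps_nth g n / odf n)
      + fps_nth g 0 * (fps_nth f n / odf n) = fps_nth (f * g) n / odf n) sequentially"
    using eventually_gt_at_top[of 0]
  proof eventually_elim
    case (elim n)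
    have "f * g = f' * g' + fps_const (fps_nth f 0) * g + fps_const (fps_nth g 0) * f
        - fps_const (fps_nth f 0 * fps_nth g 0)"
      unfolding f'_def g'_def fps_const_mult [symmetric] by (simp add: algebra_simps)
    hence "fps_nth (f * g) n = fps_nth (f' * g') n + fps_nth f 0 * fps_nth g n
        + fps_nth g 0 * fps_nth f n"
      using elim by simp
    thus ?case by (simp add: add_divide_distrib)
  qed
  ultimately show ?thesis by (simp add: filterlim_cong)
qed

text \<open>As kappa v = 1, the negligible product (kappa - 1)(v - 1) equals 2 - kappa - v, so v = 1
  / kappa has limit ratio -1. The coefficients of \<open>chi\<close> are those of
  \<open>kappa\<close> delayed by one, with ratio 0. The Leibniz rule for limit ratios combines
  these.\<close>

lemma Yser_limit: "(\<lambda>n. fps_nth Yser n / odf n) \<longlonglongrightarrow> 1"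
proof -
  define v where "v = inverse kappa"
  have v: "odf_bounded 0 v" "fps_nth v 0 = 1"
    by (auto simp: v_def intro!: odf_bounded_inverse odf_bounded_kappa)
  have one: "odf_bounded 0 (-1)" by (intro odf_bounded_uminus odf_bounded_1)
  have "(\<lambda>n. fps_nth ((kappa - 1) * (v - 1)) n) \<in> O(\<lambda>n. odf (n - Suc 0))"
    by (rule odf_bounded_mult_high_order)
      (auto simp: v intro!: odf_bounded_diff odf_bounded_1 v odf_bounded_kappa)
  hence "(\<lambda>n. fps_nth ((kappa - 1) * (v - 1)) n / odf n) \<longlonglongrightarrow> 0"
    by (intro bigo_odf_pred_limit) simp
  hence "(\<lambda>n. - 1 - fps_nth ((kappa - 1) * (v - 1)) n / odf n) \<longlonglongrightarrow> - 1 - 0"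
    by (intro tendsto_intros)
  moreover have "eventually (\<lambda>n. - 1 - fps_nth ((kappa - 1) * (v - 1)) n / odf n
      = fps_nth v n / odf n) sequentially"
    using eventually_gt_at_top[of 0]
  proof eventually_elim
    case (elim n)
    have "(kappa - 1) * (v - 1) = 2 - kappa - v"
      using kappa_inverse by (simp add: v_def algebra_simps)
    thus ?case using elim by (simp add: field_simps fps_numeral_nth)
  qed
  ultimately have vl: "(\<lambda>n. fps_nth v n / odf n) \<longlonglongrightarrow> -1" by (simp add: filterlim_cong)
  have "(\<lambda>n. fps_nth chi n / odf n) \<longlonglongrightarrow> 0"
  proof (rule Lim_transform_eventually[OF odf_pred_ratio])
    show "eventually (\<lambda>n. odf (n - 1) / odf n = fps_nth chi n / odf n) sequentially"
      using eventually_gt_at_top[of 0] by eventually_elim (simp add: chi_eq)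
  qed
  with odf_bounded_chi have "(\<lambda>n. fps_nth (chi * chi) n / odf n) \<longlonglongrightarrow> 0"
    using odf_mult_limit[of chi 0 chi 0] by simp
  hence "(\<lambda>n. fps_nth (chi * chi * v) n / odf n) \<longlonglongrightarrow> -1"
    using odf_mult_limit[of "chi * chi" 0 v "-1"] v vl odf_bounded_chi
    by (simp add: odf_bounded_mult)
  hence "(\<lambda>n. - (fps_nth (chi * chi * v) n / odf n)) \<longlonglongrightarrow> - (-1)"
    by (intro tendsto_intros)
  moreover have "eventually (\<lambda>n. - (fps_nth (chi * chi * v) n / odf n) = fps_nth Yser n / odf n) sequentially"
    using eventually_gt_at_top[of 0]
    by eventually_elim (simp add: Yser_def v_def power2_eq_square)
  ultimately show ?thesis by (simp add: filterlim_cong)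
qed

section \<open>The linearized recurrence\<close>


lemma odf_shift_mono: "f \<in> O(\<lambda>n. odf (n - S)) \<Longrightarrow> R \<le> S \<Longrightarrow> f \<in> O(\<lambda>n. odf (n - R))"
  by (erule landau_o.big_trans) (auto intro!: bigoI[of _ 1] always_eventually odf_mono)

lemma bigo_odf_delay:
  assumes "f \<in> O(\<lambda>n. odf (n - R))"
  shows "(\<lambda>n. f (n - i)) \<in> O(\<lambda>n. odf (n - (R + i)))"
proof -
  have "filterlim (\<lambda>n. n - i) at_top (at_top :: nat filter)"
    by (simp add: filterlim_minus_const_nat_at_top)
  from landau_o.big.compose[OF assms this] show ?thesis
    by (simp add: add.commute)
qed

lemma bigo_odf_times_n:
  assumes "f \<in> O(\<lambda>n. odf (n - Suc R))"
  shows "(\<lambda>n. real n * f n) \<in> O(\<lambda>n. odf (n - R))"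
proof -
  have "(\<lambda>n. real n * odf (n - Suc R)) \<in> O(\<lambda>n. odf (n - R))"
  proof (rule bigoI[where c = "real (Suc R)"])
    show "\<forall>\<^sub>F n in at_top. norm (real n * odf (n - Suc R)) \<le> real (Suc R) * norm (odf (n - R))"
      using eventually_gt_at_top[of R]
    proof eventually_elim
      case (elim n)
      then obtain m where m: "n = Suc (R + m)" by (auto dest: less_imp_Suc_add)
      have "real n \<le> real (Suc R) * (2 * real m + 3)"
        by (simp add: m algebra_simps)
      hence "real n * odf m \<le> real (Suc R) * (2 * real m + 3) * odf m"
        by (intro mult_right_mono) auto
      thus ?case by (simp add: m odf_Suc mult_ac abs_mult)
    qed
  qed
  moreover have "(\<lambda>n. real n * f n) \<in> O(\<lambda>n. real n * odf (n - Suc R))"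
    by (intro landau_o.big.mult_left assms)
  ultimately show ?thesis by (rule landau_o.big_trans[rotated])
qed

section \<open>Products with polynomials\<close>

definition fps_finite :: "real fps \<Rightarrow> bool" where
  "fps_finite f \<longleftrightarrow> (\<exists>N. \<forall>i>N. fps_nth f i = 0)"

lemma fps_finite_intros:
  shows fps_finite_const: "fps_finite (fps_const c)"
    and fps_finite_X: "fps_finite fps_X"
    and fps_finite_cutoff: "fps_finite (fps_cutoff n f)"
  unfolding fps_finite_def by (auto intro: exI[of _ 1] exI[of _ n])

lemma fps_finite_add: "fps_finite f \<Longrightarrow> fps_finite g \<Longrightarrow> fps_finite (f + g)"
  unfolding fps_finite_def
proof (elim exE)
  fix M N assume "\<forall>i>M. fps_nth f i = 0" "\<forall>i>N. fps_nth g i = 0"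
  thus "\<exists>N. \<forall>i>N. fps_nth (f + g) i = 0" by (intro exI[of _ "max M N"]) auto
qed

lemma fps_finite_uminus: "fps_finite f \<Longrightarrow> fps_finite (- f)"
  unfolding fps_finite_def by auto

lemma fps_finite_diff: "fps_finite f \<Longrightarrow> fps_finite g \<Longrightarrow> fps_finite (f - g)"
  using fps_finite_add[of f "-g"] fps_finite_uminus[of g] by simp

lemma fps_finite_mult: "fps_finite f \<Longrightarrow> fps_finite g \<Longrightarrow> fps_finite (f * g)"
  unfolding fps_finite_def
proof (elim exE)
  fix M N assume *: "\<forall>i>M. fps_nth f i = 0" "\<forall>i>N. fps_nth g i = 0"
  have "fps_nth f i * fps_nth g (n - i) = 0" if "n > M + N" "i \<le> n" for i n
    using * that by (cases "i > M") auto
  thus "\<exists>N. \<forall>i>N. fps_nth (f * g) i = 0"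
    by (intro exI[of _ "M + N"]) (auto simp: fps_mult_nth intro!: sum.neutral)
qed

lemma fps_finite_deriv: "fps_finite f \<Longrightarrow> fps_finite (fps_deriv f)"
  unfolding fps_finite_def by auto (metis less_SucI)

text \<open>A polynomial factor produces finitely many delays of \<open>f\<close>, and the smallest
  delay \<open>m\<close> dominates. An infinite series would add terms q_n f_0, over which the
  eventual bound on \<open>f\<close> has no control.\<close>

lemma bigo_odf_finite_mult:
  assumes q: "fps_finite q" "\<And>i. i < m \<Longrightarrow> fps_nth q i = 0"
    and f: "fps_nth f \<in> O(\<lambda>n. odf (n - R))"
  shows "fps_nth (q * f) \<in> O(\<lambda>n. odf (n - (R + m)))"
proof -
  from q(1) obtain N where N: "\<And>i. i > N \<Longrightarrow> fps_nth q i = 0"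
    unfolding fps_finite_def by blast
  have "(\<lambda>n. \<Sum>i\<in>{m..N}. fps_nth q i * fps_nth f (n - i)) \<in> O(\<lambda>n. odf (n - (R + m)))"
  proof (rule big_sum_in_bigo)
    fix i assume "i \<in> {m..N}"
    hence "(\<lambda>n. fps_nth f (n - i)) \<in> O(\<lambda>n. odf (n - (R + m)))"
      using bigo_odf_delay[OF f, of i] by (auto elim: odf_shift_mono)
    thus "(\<lambda>n. fps_nth q i * fps_nth f (n - i)) \<in> O(\<lambda>n. odf (n - (R + m)))"
      by simp
  qed
  also have "?this \<longleftrightarrow> ?thesis"
  proof (rule landau_o.big.in_cong)
    show "\<forall>\<^sub>F n in at_top. (\<Sum>i\<in>{m..N}. fps_nth q i * fps_nth f (n - i)) = fps_nth (q * f) n"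
      using eventually_ge_at_top[of N]
    proof eventually_elim
      case (elim n)
      show ?case unfolding fps_mult_nth
        by (rule sum.mono_neutral_left) (use elim q N in \<open>auto simp: not_le\<close>)
    qed
  qed
  finally show ?thesis .
qed

text \<open>The linearization at \<open>y\<close>, with \<open>y\<close> replaced by a polynomial \<open>p\<close> approximating it, of
  the coefficient recurrence \<open>y = (x y\<^sup>2)' + x y\<^sup>2 - 2 x y\<close> (valid beyond order \<open>1\<close>).\<close>

definition lin_op :: "real fps \<Rightarrow> real fps \<Rightarrow> real fps" where
  "lin_op p f = f - fps_const 2 * (fps_X * fps_deriv (p * f) + p * f)
     - fps_const 2 * (fps_X * (p * f)) + fps_const 2 * (fps_X * f)"

lemma lin_op_nth_Suc:
  "fps_nth (lin_op p f) (Suc n) = fps_nth f (Suc n) - 2 * (real n + 2) * fps_nth (p * f) (Suc n)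
     - 2 * fps_nth (p * f) n + 2 * fps_nth f n"
  unfolding lin_op_def fps_mult_fps_X_deriv_shift by (simp, simp add: algebra_simps)

lemma telescoping_limit:
  fixes t G :: "nat \<Rightarrow> real"
  assumes step: "\<And>n. n \<ge> N \<Longrightarrow> \<bar>t (Suc n) - t n\<bar> \<le> G n - G (Suc n)" and G: "G \<longlonglongrightarrow> 0"
  obtains l where "t \<longlonglongrightarrow> l" "\<And>n. n \<ge> N \<Longrightarrow> \<bar>t n - l\<bar> \<le> G n"
proof -
  have diff: "\<bar>t m - t n\<bar> \<le> G n - G m" if "n \<ge> N" "m \<ge> n" for m n
    using that(2)
  proof (induction m rule: dec_induct)
    case (step m)
    thus ?case using assms(1)[of m] that by linarith
  qed auto
  have Gnn: "G n \<ge> 0" if "n \<ge> N" for n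
  proof (rule LIMSEQ_le_const2[OF G])
    show "\<exists>M. \<forall>m\<ge>M. G m \<le> G n"
    proof (intro exI allI impI)
      fix m assume "m \<ge> n"
      thus "G m \<le> G n" using diff[of n m] that by linarith
    qed
  qed
  have "Cauchy t"
  proof (rule metric_CauchyI)
    fix e :: real assume "e > 0"
    hence "e / 2 > 0" by simp
    from tendstoD[OF G this] have "eventually (\<lambda>n. \<bar>G n\<bar> < e / 2) sequentially"
      by (simp add: dist_real_def)
    then obtain M where M: "\<And>n. n \<ge> M \<Longrightarrow> \<bar>G n\<bar> < e / 2"
      unfolding eventually_at_top_linorder by blast
    define n where "n = max M N"
    have "dist (t m) (t n) < e / 2" if "m \<ge> n" for m
      using diff[of n m] M[of n] Gnn[of m] that by (auto simp: n_def dist_real_def)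
    hence "dist (t m) (t k) < e" if "m \<ge> n" "k \<ge> n" for m k
      using that by (metis dist_commute dist_triangle_half_l)
    thus "\<exists>M. \<forall>m\<ge>M. \<forall>n\<ge>M. dist (t m) (t n) < e" by blast
  qed
  then obtain l where l: "t \<longlonglongrightarrow> l"
    using Cauchy_convergent convergent_def by blast
  have "\<bar>t n - l\<bar> \<le> G n" if "n \<ge> N" for n
  proof (rule LIMSEQ_le_const2)
    show "(\<lambda>m. \<bar>t n - t m\<bar>) \<longlonglongrightarrow> \<bar>t n - l\<bar>" by (intro tendsto_intros l)
    show "\<exists>M. \<forall>m\<ge>M. \<bar>t n - t m\<bar> \<le> G n"
      using diff[of n] Gnn that by (intro exI[of _ n]) (smt (verit) order.trans)
  qed
  with l show ?thesis by (rule that)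
qed

text \<open>With m = n - R - 1, both ratios on the right have denominator \<open>odf (Suc n)\<close>
  and numerators (2n+3) and (2m+3) times \<open>odf m\<close>; 2 (n - m) = 2R + 2 remains. This sums
  the increments of the recurrence exactly.\<close>

lemma odf_ratio_telescope:
  assumes "n \<ge> Suc R"
  shows "(2 * real R + 2) * (odf (Suc n - (R + 2)) / odf (Suc n))
      = odf (n - Suc R) / odf n - odf (Suc n - Suc R) / odf (Suc n)"
proof -
  obtain m where n: "n = Suc R + m" using assms le_Suc_ex by blast
  have "odf (n - Suc R) / odf n = (2 * real n + 3) * odf m / odf (Suc n)"
    by (simp add: n odf_Suc divide_simps)
  moreover have "odf (Suc n - Suc R) = (2 * real m + 3) * odf m"
    by (simp add: n odf_Suc Suc_diff_le)
  moreover have "odf (Suc n - (R + 2)) = odf m" by (simp add: n)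
  ultimately show ?thesis
    by (simp add: n diff_divide_distrib [symmetric] add_divide_distrib [symmetric] algebra_simps)
qed

text \<open>Dividing by \<open>odf n\<close> turns the recurrence into one with summable increments,
  which yields a limit. If the limit is 0, the tail of the increments is itself the improved bound:
  a residual two orders smaller gains one order.\<close>

lemma lin_op_bootstrap:
  assumes p: "fps_finite p" "fps_nth p 0 = 0" "fps_nth p 1 = 1" "fps_nth p 2 = 1"
    and e: "fps_nth e \<in> O(\<lambda>n. odf (n - R))"
    and lin: "fps_nth (lin_op p e) \<in> O(\<lambda>n. odf (n - (R + 2)))"
  shows lin_op_limit: "\<exists>l. (\<lambda>n. fps_nth e n / odf n) \<longlonglongrightarrow> l"
    and lin_op_improve: "(\<lambda>n. fps_nth e n / odf n) \<longlonglongrightarrow> 0 \<Longrightarrow> fps_nth e \<in> O(\<lambda>n. odf (n - Suc R))"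
proof -
  define r where "r = p - fps_X - fps_X ^ 2"
  have fin: "fps_finite r"
    unfolding r_def power2_eq_square by (intro fps_finite_diff fps_finite_mult fps_finite_X p)
  have r: "fps_nth r i = 0" if "i < 3" for i
  proof -
    from that have "i = 0 \<or> i = 1 \<or> i = 2" by auto
    thus ?thesis using p by (auto simp: r_def fps_X_power_nth)
  qed
  have re: "fps_nth (r * e) \<in> O(\<lambda>n. odf (n - (R + 3)))"
    by (rule bigo_odf_finite_mult[OF fin r e])
  have pe: "p * e = fps_X * e + fps_X * (fps_X * e) + r * e"
    by (simp add: r_def algebra_simps power2_eq_square)
  \<comment> \<open>Adding the delayed neighbour absorbs the x^2 term of \<open>p\<close>. Up to
    admissible errors \<theta>_n = (2n+1) \<theta>_(n-1), the recurrence satisfied by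
    \<open>odf\<close>.\<close>
  define \<theta> where "\<theta> = (\<lambda>n. fps_nth e n + fps_nth e (n - 1))"
  define \<delta> where "\<delta> = (\<lambda>n. \<theta> n - (2 * real n + 1) * \<theta> (n - 1))"
  have mono: "f \<in> O(\<lambda>n. odf (n - (R + 3))) \<Longrightarrow> f \<in> O(\<lambda>n. odf (n - (R + 2)))" for f
    by (erule odf_shift_mono) auto
  have "(\<lambda>n. fps_nth (lin_op p e) n + 2 * (real n * fps_nth (r * e) n) + 2 * fps_nth (r * e) n
      + 2 * fps_nth (r * e) (n - 1) + 3 * fps_nth e (n - 2) + 2 * fps_nth e (n - 3))
      \<in> O(\<lambda>n. odf (n - (R + 2)))"
  proof (intro sum_in_bigo lin)
    show "(\<lambda>n. 2 * (real n * fps_nth (r * e) n)) \<in> O(\<lambda>n. odf (n - (R + 2)))"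
      using bigo_odf_times_n[of "fps_nth (r * e)" "R + 2"] re by (simp add: eval_nat_numeral)
    show "(\<lambda>n. 2 * fps_nth (r * e) n) \<in> O(\<lambda>n. odf (n - (R + 2)))"
      using mono[OF re] by simp
    show "(\<lambda>n. 2 * fps_nth (r * e) (n - 1)) \<in> O(\<lambda>n. odf (n - (R + 2)))"
      using bigo_odf_delay[OF mono[OF re], of 1] by (auto elim: odf_shift_mono)
    show "(\<lambda>n. 3 * fps_nth e (n - 2)) \<in> O(\<lambda>n. odf (n - (R + 2)))"
      using bigo_odf_delay[OF e, of 2] by simp
    show "(\<lambda>n. 2 * fps_nth e (n - 3)) \<in> O(\<lambda>n. odf (n - (R + 2)))"
      using mono[OF bigo_odf_delay[OF e, of 3]] by simp
  qed
  also have "?this \<longleftrightarrow> \<delta> \<in> O(\<lambda>n. odf (n - (R + 2)))"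
  proof (rule landau_o.big.in_cong)
    show "\<forall>\<^sub>F n in at_top. fps_nth (lin_op p e) n + 2 * (real n * fps_nth (r * e) n)
        + 2 * fps_nth (r * e) n + 2 * fps_nth (r * e) (n - 1) + 3 * fps_nth e (n - 2)
        + 2 * fps_nth e (n - 3) = \<delta> n"
      using eventually_ge_at_top[of 3]
    proof eventually_elim
      case (elim n)
      then obtain k where k: "n = Suc (Suc (Suc k))"
        using le_Suc_ex[of 3 n] by (auto simp: eval_nat_numeral)
      show ?case unfolding k lin_op_nth_Suc \<delta>_def \<theta>_def pe
        by (simp add: algebra_simps)
    qed
  qed
  finally have \<delta>: "\<delta> \<in> O(\<lambda>n. odf (n - (R + 2)))" .

  define \<tau> where "\<tau> = (\<lambda>n. \<theta> n / odf n)"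
  obtain K where K: "K > 0"
    "eventually (\<lambda>n. \<bar>\<delta> n\<bar> \<le> K * odf (n - (R + 2))) at_top"
    using landau_o.bigE[OF \<delta>] by (auto simp: )
  define G where "G = (\<lambda>n. K / (2 * real R + 2) * (odf (n - Suc R) / odf n))"
  from K(2) obtain N where N: "\<And>n. n \<ge> N \<Longrightarrow> \<bar>\<delta> n\<bar> \<le> K * odf (n - (R + 2))"
    by (auto simp: eventually_at_top_linorder)
  define N' where "N' = max N (Suc R)"
  have step: "\<bar>\<tau> (Suc n) - \<tau> n\<bar> \<le> G n - G (Suc n)" if "n \<ge> N'" for n
  proof -
    have "\<tau> (Suc n) - \<tau> n = \<delta> (Suc n) / odf (Suc n)"
    proof -
      have "(2 * real n + 3) * \<theta> n / odf (Suc n) = \<tau> n"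
        unfolding \<tau>_def odf_Suc by (rule nonzero_mult_divide_mult_cancel_left) (simp add: add_nonneg_eq_0_iff)
      moreover have "\<theta> (Suc n) = \<delta> (Suc n) + (2 * real n + 3) * \<theta> n"
        by (simp add: \<delta>_def algebra_simps)
      ultimately show ?thesis by (simp add: \<tau>_def add_divide_distrib)
    qed
    hence "\<bar>\<tau> (Suc n) - \<tau> n\<bar> = \<bar>\<delta> (Suc n)\<bar> / odf (Suc n)" by simp
    also have "\<dots> \<le> K * odf (Suc n - (R + 2)) / odf (Suc n)"
      using N[of "Suc n"] that by (intro divide_right_mono) (auto simp: N'_def)
    also have "\<dots> = K / (2 * real R + 2) * ((2 * real R + 2) * (odf (Suc n - (R + 2)) / odf (Suc n)))"
    proof -
      have "2 * real R + 2 \<noteq> 0" by linarith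
      thus ?thesis by (simp del: distrib_left_numeral)
    qed
    also have "\<dots> = G n - G (Suc n)"
      using that by (subst odf_ratio_telescope) (auto simp: N'_def G_def algebra_simps)
    finally show ?thesis .
  qed
  have "(\<lambda>n. odf (n - Suc R)) \<in> O(\<lambda>n. odf (n - 1))"
    by (rule odf_shift_mono[where S = "Suc R"]) auto
  from bigo_odf_pred_limit[OF this] have "G \<longlonglongrightarrow> K / (2 * real R + 2) * 0"
    unfolding G_def by (intro tendsto_intros)
  hence G0: "G \<longlonglongrightarrow> 0" by simp
  obtain l where l: "\<tau> \<longlonglongrightarrow> l" "\<And>n. n \<ge> N' \<Longrightarrow> \<bar>\<tau> n - l\<bar> \<le> G n"
    using telescoping_limit[OF step G0] by blast
  have e1: "(\<lambda>n. fps_nth e (n - 1)) \<in> O(\<lambda>n. odf (n - Suc R))"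
    using bigo_odf_delay[OF e, of 1] by simp
  have "(\<lambda>n. fps_nth e (n - 1)) \<in> O(\<lambda>n. odf (n - 1))"
    using e1 by (rule odf_shift_mono) auto
  hence "(\<lambda>n. \<tau> n - fps_nth e (n - 1) / odf n) \<longlonglongrightarrow> l - 0"
    by (intro tendsto_intros l bigo_odf_pred_limit)
  hence lim: "(\<lambda>n. fps_nth e n / odf n) \<longlonglongrightarrow> l"
    by (simp add: \<tau>_def \<theta>_def add_divide_distrib)
  thus "\<exists>l. (\<lambda>n. fps_nth e n / odf n) \<longlonglongrightarrow> l" ..
  assume "(\<lambda>n. fps_nth e n / odf n) \<longlonglongrightarrow> 0"
  with lim have "l = 0" using LIMSEQ_unique by blast
  have "\<theta> \<in> O(\<lambda>n. odf (n - Suc R))"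
  proof (rule bigoI[where c = "K / (2 * real R + 2)"])
    show "\<forall>\<^sub>F n in at_top. norm (\<theta> n) \<le> K / (2 * real R + 2) * norm (odf (n - Suc R))"
      using eventually_ge_at_top[of N']
    proof eventually_elim
      case (elim n)
      define c where "c = K / (2 * real R + 2)"
      have "\<bar>\<theta> n\<bar> / odf n \<le> (c * odf (n - Suc R)) / odf n"
        using l(2)[OF elim] by (simp add: \<open>l = 0\<close> \<tau>_def G_def c_def)
      thus ?case unfolding c_def [symmetric] by (simp add: divide_le_cancel)
    qed
  qed
  hence "(\<lambda>n. \<theta> n - fps_nth e (n - 1)) \<in> O(\<lambda>n. odf (n - Suc R))"
    by (intro sum_in_bigo e1)
  thus "fps_nth e \<in> O(\<lambda>n. odf (n - Suc R))" by (simp add: \<theta>_def)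
qed

section \<open>The asymptotic expansion up to a constant factor\<close>


lemma fps_finite_bigo: "fps_finite f \<Longrightarrow> fps_nth f \<in> O(g)"
proof -
  assume "fps_finite f"
  then obtain N where N: "\<And>i. i > N \<Longrightarrow> fps_nth f i = 0"
    unfolding fps_finite_def by blast
  have "eventually (\<lambda>n. norm (fps_nth f n) \<le> 1 * norm (g n)) at_top"
    using eventually_gt_at_top[of N] by eventually_elim (simp add: N)
  thus ?thesis by (rule bigoI)
qed

lemma odf_bounded_fps_finite: "fps_finite f \<Longrightarrow> odf_bounded a f"
  unfolding fps_finite_def
proof (elim exE)
  fix N assume "\<forall>i>N. fps_nth f i = 0"
  thus "odf_bounded a f" by (intro odf_bounded_of_finite[where N = "Suc N" and K = 0]) auto
qed

text \<open>Write y^2 = 2 p y + (y - p)^2 - p^2. The first term is what the linearization keeps, p^2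
  is a polynomial, and (y - p)^2 has order \<open>odf (n - Suc L)\<close>; the factor n of the
  recurrence costs one index.\<close>

lemma lin_op_yser:
  "fps_nth (lin_op (fps_cutoff (Suc L) yser) yser) \<in> O(\<lambda>n. odf (n - L))"
proof -
  define p where "p = fps_cutoff (Suc L) yser"
  define m where "m = (yser - p) * (yser - p) - p * p"
  have p: "fps_finite p" unfolding p_def by (rule fps_finite_cutoff)
  have 1: "fps_nth ((yser - p) * (yser - p)) \<in> O(\<lambda>n. odf (n - Suc L))"
    by (rule odf_bounded_mult_high_order)
      (auto simp: p_def intro!: odf_bounded_diff[OF odf_bounded_yser odf_bounded_fps_finite] fps_finite_cutoff)
  have m: "fps_nth m \<in> O(\<lambda>n. odf (n - Suc L))"
    unfolding m_def fps_sub_nth by (intro sum_in_bigo 1 fps_finite_bigo fps_finite_mult p)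
  have "(\<lambda>n. real n * fps_nth m n + fps_nth m n + fps_nth m (n - 1)) \<in> O(\<lambda>n. odf (n - L))"
  proof (intro sum_in_bigo)
    show "(\<lambda>n. real n * fps_nth m n) \<in> O(\<lambda>n. odf (n - L))"
      by (rule bigo_odf_times_n[OF m])
    show "fps_nth m \<in> O(\<lambda>n. odf (n - L))" by (rule odf_shift_mono[OF m]) simp
    show "(\<lambda>n. fps_nth m (n - 1)) \<in> O(\<lambda>n. odf (n - L))"
      by (rule odf_shift_mono[OF bigo_odf_delay[OF m]]) simp
  qed
  also have "?this \<longleftrightarrow> fps_nth (lin_op p yser) \<in> O(\<lambda>n. odf (n - L))"
  proof (rule landau_o.big.in_cong)
    show "\<forall>\<^sub>F n in at_top. real n * fps_nth m n + fps_nth m n + fps_nth m (n - 1)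
        = fps_nth (lin_op p yser) n"
      using eventually_ge_at_top[of 2]
    proof eventually_elim
      case (elim n)
      then obtain k where k: "n = Suc k" "k \<ge> 1" by (cases n) auto
      have sq: "yser ^ 2 = p * yser + p * yser + m"
        by (simp add: m_def power2_eq_square algebra_simps)
      show ?case unfolding k(1) lin_op_nth_Suc yser_rec[OF k(2)] unfolding sq fps_add_nth
        by (simp add: algebra_simps)
    qed
  qed
  finally show ?thesis by (simp only: p_def)
qed

section \<open>The differential equation for the generating function of the c_k\<close>

definition wser :: "real fps" where "wser = fps_shift 1 yser"

lemma yser_eq: "yser = fps_X * wser"
proof (rule fps_ext)
  fix n show "fps_nth yser n = fps_nth (fps_X * wser) n"
    by (cases n) (simp_all add: wser_def)
qed

lemma wser_nths:
  "fps_nth wser 0 = 1" "fps_nth wser 1 = 1" "fps_nth wser 2 = 7" "fps_nth wser 3 = 63"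
  "fps_nth wser 4 = 729"
  using yser_nths by (simp_all add: wser_def eval_nat_numeral)

text \<open>Up to the factor \<open>x \<kappa>\<close> and a polynomial remainder, \<open>bracket w q\<close> is the linearized
  operator applied to \<open>\<kappa> q\<close>. Its vanishing is a differential equation for the generating
  function \<open>q\<close> of the coefficients of the asymptotic expansion.\<close>

definition bracket :: "real fps \<Rightarrow> real fps \<Rightarrow> real fps" where
  "bracket w q = fps_shift 1 (1 - w) * q - w * q - fps_const 2 * (fps_X * fps_deriv (w * q))
     - fps_const 2 * (fps_X * (w * q)) + fps_const 2 * q"

lemma fps_eq_1_plus_shift: "fps_nth w 0 = 1 \<Longrightarrow> w = 1 - fps_X * fps_shift 1 (1 - w)"
  for w :: "real fps"
proof (rule fps_ext)
  fix n assume "fps_nth w 0 = 1"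
  thus "fps_nth w n = fps_nth (1 - fps_X * fps_shift 1 (1 - w)) n"
    by (cases n) simp_all
qed

text \<open>The derivative of \<open>kappa\<close> is removed by \<open>kappa_ode\<close>, whose
  inhomogeneous 1 leaves the remainder \<open>w * q\<close>. The normalization w_0 = 1 lets q - w q,
  the terms without a factor x, contribute another multiple of x.\<close>

lemma lin_op_kappa:
  assumes "fps_nth w 0 = 1"
  shows "lin_op (fps_X * w) (kappa * q) = fps_X * bracket w q * kappa + w * q"
proof -
  define s where "s = fps_shift 1 (1 - w)"
  define b where "b = w * q"
  have w: "w = 1 - fps_X * s" unfolding s_def by (rule fps_eq_1_plus_shift) (rule assms)
  have b: "b = q - fps_X * s * q" unfolding b_def by (subst w) (simp add: algebra_simps)
  have br: "bracket w q = s * q - b - 2 * (fps_X * fps_deriv b) - 2 * (fps_X * b) + 2 * q"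
    by (simp add: bracket_def s_def b_def numeral_fps_const)
  have pf: "fps_X * w * (kappa * q) = fps_X * b * kappa" by (simp add: b_def mult_ac)
  have "fps_deriv (fps_X * b * kappa) = b * kappa + fps_X * fps_deriv b * kappa + fps_X * b * fps_deriv kappa"
    by (simp add: algebra_simps)
  hence L: "lin_op (fps_X * w) (kappa * q) = kappa * q
      - 2 * (fps_X * (b * kappa + fps_X * fps_deriv b * kappa + fps_X * b * fps_deriv kappa)
        + fps_X * b * kappa) - 2 * (fps_X * (fps_X * b * kappa)) + 2 * (fps_X * (kappa * q))"
    unfolding lin_op_def pf by (simp add: numeral_fps_const)
  show ?thesis unfolding L br b_def [symmetric] using b kappa_ode by algebra
qed

lemma bracket_nth: "fps_nth (bracket w q) k = fps_nth (fps_shift 1 (1 - w) * q) k - fps_nth (w * q) k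
    - 2 * real k * fps_nth (w * q) k - 2 * (if k = 0 then 0 else fps_nth (w * q) (k - 1)) + 2 * fps_nth q k"
  unfolding bracket_def fps_mult_fps_X_deriv_shift by simp

lemma fps_mult_nth_cong:
  "(\<And>i. i \<le> k \<Longrightarrow> fps_nth f i = fps_nth f' i) \<Longrightarrow> (\<And>i. i \<le> k \<Longrightarrow> fps_nth g i = fps_nth g' i)
    \<Longrightarrow> fps_nth (f * g) k = fps_nth (f' * g') k"
  unfolding fps_mult_nth by (intro sum.cong) auto

text \<open>The shift of 1 - w reaches one coefficient further into \<open>w\<close> than into
  \<open>q\<close>, hence the different cutoffs.\<close>

lemma bracket_cutoff:
  assumes "k \<le> R"
  shows "fps_nth (bracket (fps_cutoff (R + 2) w) (fps_cutoff (Suc R) q)) k = fps_nth (bracket w q) k"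
proof -
  have 1: "fps_nth (fps_cutoff (R + 2) w * fps_cutoff (Suc R) q) j = fps_nth (w * q) j" if "j \<le> k" for j
    using that assms by (intro fps_mult_nth_cong) auto
  have 2: "fps_nth (fps_shift 1 (1 - fps_cutoff (R + 2) w) * fps_cutoff (Suc R) q) k
      = fps_nth (fps_shift 1 (1 - w) * q) k"
    using assms by (intro fps_mult_nth_cong) auto
  show ?thesis unfolding bracket_nth 2 using 1 assms by simp
qed

text \<open>The factor of q in \<open>bracket wser q\<close>, which equals cden q - 2 x w q'. It
  vanishes at 0 because w_0 = w_1 = 1, so the equation for q is regular there.\<close>

definition cden :: "real fps" where
  "cden = fps_shift 1 (1 - wser) - wser + fps_const 2 - fps_const 2 * (fps_X * fps_deriv wser)
     - fps_const 2 * (fps_X * wser)"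

text \<open>The solution of 2 w c' = c (cden / x) with c_0 = 1, as the exponential of an integral;
  its coefficients are the c_k.\<close>

definition cser :: "real fps" where
  "cser = fps_exp 1 oo fps_integral (fps_const (1 / 2) * fps_shift 1 cden * inverse wser) 0"

lemma cser_nth_0: "fps_nth cser 0 = 1"
  by (simp add: cser_def)

lemma cden_nth: "fps_nth cden k = (if k = 0 then 2 else 0) - fps_nth wser (Suc k)
    - (2 * real k + 1) * fps_nth wser k - 2 * (if k = 0 then 0 else fps_nth wser (k - 1))"
  unfolding cden_def fps_mult_fps_X_deriv_shift by (simp add: algebra_simps)

lemma cser_ode: "2 * wser * fps_deriv cser = cser * fps_shift 1 cden"
proof -
  have "fps_deriv cser = cser * (fps_const (1 / 2) * fps_shift 1 cden * inverse wser)"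
    unfolding cser_def by (simp add: fps_compose_deriv fps_deriv_fps_integral)
  moreover have "wser * inverse wser = 1"
    by (rule inverse_mult_eq_1') (simp add: wser_nths)
  moreover have "2 * fps_const (1 / 2) = (1 :: real fps)"
    by (simp add: numeral_fps_const)
  ultimately show ?thesis by algebra
qed

lemma bracket_cser: "bracket wser cser = 0"
proof -
  have "cden = fps_X * fps_shift 1 cden"
  proof (rule fps_ext)
    fix n show "fps_nth cden n = fps_nth (fps_X * fps_shift 1 cden) n"
      using wser_nths by (cases n) (simp_all add: cden_nth)
  qed
  moreover have "bracket wser cser = cden * cser - 2 * fps_X * wser * fps_deriv cser"
    unfolding bracket_def cden_def by (simp add: numeral_fps_const algebra_simps)
  ultimately show ?thesis using cser_ode by algebra
qed

lemma cser_nths: "fps_nth cser 1 = -6" "fps_nth cser 2 = -4" "fps_nth cser 3 = -(218 / 3)"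
proof -
  have *: "fps_nth (fps_const 2 * wser * fps_deriv cser) n = fps_nth (cser * fps_shift 1 cden) n" for n
    using cser_ode by (simp add: numeral_fps_const)
  have d: "fps_nth cden 1 = -12" "fps_nth cden 2 = -100" "fps_nth cden 3 = -1184"
    using wser_nths by (simp_all add: cden_nth eval_nat_numeral)
  note s = fps_mult_nth cser_nth_0 numeral_eq_Suc
  note w = wser_nths[unfolded numeral_eq_Suc, simplified] d[unfolded numeral_eq_Suc, simplified]
  show 1: "fps_nth cser 1 = -6" using *[of 0] w by (simp add: cser_nth_0)
  show 2: "fps_nth cser 2 = -4" using *[of 1] 1 w by (simp add: s)
  show 3: "fps_nth cser 3 = -(218 / 3)" using *[of 2] 1 2 w by (simp add: s)
qed

lemma lin_op_diff_const: "lin_op p (f - fps_const C * g) = lin_op p f - fps_const C * lin_op p g"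
  unfolding lin_op_def by (simp add: algebra_simps)

definition yrem :: "real \<Rightarrow> nat \<Rightarrow> real fps" where
  "yrem C R = yser - fps_const C * (kappa * fps_cutoff R cser)"

text \<open>Since \<open>cser\<close> annihilates the bracket, truncating it after c_R leaves a
  bracket starting at x^(R+1), and x times it starts at x^(R+2). Cutting y at R + 3 makes its own
  linearization error equally small.\<close>

lemma lin_op_yrem:
  "fps_nth (lin_op (fps_cutoff (R + 3) yser) (yrem C (Suc R))) \<in> O(\<lambda>n. odf (n - (R + 2)))"
proof -
  define w where "w = fps_cutoff (R + 2) wser"
  define q where "q = fps_cutoff (Suc R) cser"
  have p: "fps_cutoff (R + 3) yser = fps_X * w"
    unfolding w_def yser_eq by (auto simp: fps_eq_iff)
  have w0: "fps_nth w 0 = 1" by (simp add: w_def wser_nths)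
  have fin: "fps_finite w" "fps_finite q" "fps_finite (fps_shift 1 (1 - w))"
    by (auto simp: w_def q_def fps_finite_cutoff fps_finite_def intro!: exI[of _ "R + 2"])
  have "fps_finite (fps_X * bracket w q)"
    unfolding bracket_def
    by (intro fps_finite_mult fps_finite_add fps_finite_diff fps_finite_deriv fps_finite_const fps_finite_X fin)
  moreover have "fps_nth (fps_X * bracket w q) i = 0" if "i < R + 2" for i
    using that bracket_cutoff[of "i - 1" R wser cser] unfolding w_def q_def
    by (cases i) (simp_all add: bracket_cser)
  moreover have "fps_nth kappa \<in> O(\<lambda>n. odf (n - 0))"
    by (simp add: kappa_nth [abs_def])
  ultimately have "fps_nth (fps_X * bracket w q * kappa) \<in> O(\<lambda>n. odf (n - (0 + (R + 2))))"
    by (rule bigo_odf_finite_mult)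
  hence "fps_nth (lin_op (fps_X * w) (kappa * q)) \<in> O(\<lambda>n. odf (n - (R + 2)))"
    using fps_finite_bigo[OF fps_finite_mult[OF fin(1,2)]]
    unfolding lin_op_kappa[OF w0] fps_add_nth by (intro sum_in_bigo) simp_all
  moreover have "fps_nth (lin_op (fps_X * w) yser) \<in> O(\<lambda>n. odf (n - (R + 2)))"
    using lin_op_yser[of "R + 2"] p by (simp add: eval_nat_numeral)
  ultimately show ?thesis
    unfolding p yrem_def q_def [symmetric] lin_op_diff_const fps_sub_nth fps_mult_left_const_nth
    by (intro sum_in_bigo landau_o.big.cmult_in_iff') auto
qed

lemma yser_limit_ex: "\<exists>C. (\<lambda>n. fps_nth yser n / odf n) \<longlonglongrightarrow> C"
proof (rule lin_op_limit)
  obtain K where K: "\<And>n. \<bar>fps_nth yser n\<bar> \<le> K * odf (n + 0)"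
    using odf_bounded_yser by (rule odf_boundedE) blast
  thus "fps_nth yser \<in> O(\<lambda>n. odf (n - 0))"
    by (intro bigoI[of _ K] always_eventually) auto
  show "fps_nth (lin_op (fps_cutoff 3 yser) yser) \<in> O(\<lambda>n. odf (n - (0 + 2)))"
    using lin_op_yser[of 2] by (simp add: eval_nat_numeral)
qed (simp_all add: fps_finite_cutoff yser_nth_2)

text \<open>Each step of the induction applies \<open>lin_op_improve\<close>. The limit 0 that it
  requires holds for R = 0 by the choice of C and c_0 = 1, and for R > 0 because the remainder is
  already of order \<open>odf (n - 1)\<close>.\<close>

lemma yrem_bigo:
  assumes "(\<lambda>n. fps_nth yser n / odf n) \<longlonglongrightarrow> C"
  shows "fps_nth (yrem C R) \<in> O(\<lambda>n. odf (n - R))"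
proof (induction R)
  case 0
  obtain K where K: "\<And>n. \<bar>fps_nth yser n\<bar> \<le> K * odf (n + 0)"
    using odf_bounded_yser by (rule odf_boundedE) blast
  thus ?case
    by (intro bigoI[of _ K] always_eventually) (auto simp: yrem_def)
next
  case (Suc R)
  have "fps_cutoff (Suc R) cser = fps_cutoff R cser + fps_const (fps_nth cser R) * fps_X ^ R"
    by (auto simp: fps_eq_iff fps_X_power_nth less_Suc_eq)
  hence rec: "yrem C (Suc R) = yrem C R - fps_const (C * fps_nth cser R) * (fps_X ^ R * kappa)"
    by (simp add: yrem_def algebra_simps flip: fps_const_mult)
  have fin: "fps_finite (fps_X ^ R)"
    by (auto simp: fps_finite_def fps_X_power_nth)
  have "fps_nth (fps_X ^ R * kappa) \<in> O(\<lambda>n. odf (n - (0 + R)))"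
    by (rule bigo_odf_finite_mult[OF fin]) (auto simp: fps_X_power_nth)
  hence e: "fps_nth (yrem C (Suc R)) \<in> O(\<lambda>n. odf (n - R))"
    unfolding rec fps_sub_nth fps_mult_left_const_nth by (intro sum_in_bigo Suc.IH) auto
  have lim: "(\<lambda>n. fps_nth (yrem C (Suc R)) n / odf n) \<longlonglongrightarrow> 0"
  proof (cases "R = 0")
    case True
    have "(\<lambda>n. fps_nth yser n / odf n - C) \<longlonglongrightarrow> C - C" by (intro tendsto_intros assms)
    also have "(\<lambda>n. fps_nth yser n / odf n - C) = (\<lambda>n. fps_nth (yrem C (Suc R)) n / odf n)"
      unfolding rec unfolding True by (simp add: yrem_def cser_nth_0 diff_divide_distrib)
    finally show ?thesis by simp
  next
    case False
    thus ?thesis using odf_shift_mono[OF e, of 1] by (intro bigo_odf_pred_limit) auto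
  qed
  show ?case
    by (rule lin_op_improve[OF _ _ _ _ e lin_op_yrem lim])
      (simp_all add: fps_finite_cutoff yser_nth_2)
qed

section \<open>The constant factor\<close>


lemma odf_add_asymp: "(\<lambda>n. odf (n + j) / (odf n * real n ^ j)) \<longlonglongrightarrow> 2 ^ j"
proof (induction j)
  case (Suc j)
  have "(\<lambda>n. 2 + (2 * real j + 3) * inverse (real n)) \<longlonglongrightarrow> 2 + (2 * real j + 3) * 0"
    by (intro tendsto_intros lim_inverse_n)
  with Suc.IH have "(\<lambda>n. odf (n + j) / (odf n * real n ^ j) * (2 + (2 * real j + 3) * inverse (real n)))
      \<longlonglongrightarrow> 2 ^ j * (2 + (2 * real j + 3) * 0)"
    by (rule tendsto_mult)
  moreover have "eventually (\<lambda>n. odf (n + j) / (odf n * real n ^ j) * (2 + (2 * real j + 3) * inverse (real n))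
      = odf (n + Suc j) / (odf n * real n ^ Suc j)) sequentially"
    using eventually_gt_at_top[of 0] by eventually_elim (simp add: odf_Suc field_simps)
  ultimately show ?case by (simp add: filterlim_cong mult.commute)
qed simp

lemma binomial_asymp: "(\<lambda>n. real (n choose k) / real n ^ k) \<longlonglongrightarrow> 1 / fact k"
proof (induction k)
  case (Suc k)
  have "(\<lambda>n. (1 - real k * inverse (real n)) / real (Suc k)) \<longlonglongrightarrow> (1 - real k * 0) / real (Suc k)"
    by (intro tendsto_intros lim_inverse_n) auto
  with Suc.IH have "(\<lambda>n. real (n choose k) / real n ^ k * ((1 - real k * inverse (real n)) / real (Suc k)))
      \<longlonglongrightarrow> 1 / fact k * ((1 - real k * 0) / real (Suc k))"
    by (rule tendsto_mult)
  moreover have "eventually (\<lambda>n. real (n choose k) / real n ^ k * ((1 - real k * inverse (real n)) / real (Suc k))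
      = real (n choose Suc k) / real n ^ Suc k) sequentially"
    using eventually_gt_at_top[of 0]
  proof eventually_elim
    case (elim n)
    have "real (Suc k) * real (n choose Suc k) = (real n - real k) * real (n choose k)"
      using gbinomial_mult_1[of "real n" k] unfolding binomial_gbinomial by (simp add: algebra_simps)
    hence "real (n choose Suc k) = (real n - real k) * real (n choose k) / real (Suc k)"
      by (simp add: field_simps)
    show ?case unfolding \<open>real (n choose Suc k) = _\<close> using elim
      by (simp add: field_simps del: of_nat_Suc)
  qed
  ultimately show ?case by (simp add: filterlim_cong mult.commute)
qed simp

text \<open>In the binomial expansion of (1 + x g)^n only k \<le> j contributes to the coefficient
  of x^j, and of these only k = j reaches the order n^j.\<close>

lemma fps_power_nth_asymp:
  fixes f :: "real fps"
  assumes "fps_nth f 0 = 1"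
  shows "(\<lambda>n. fps_nth (f ^ n) j / real n ^ j) \<longlonglongrightarrow> fps_nth f 1 ^ j / fact j"
proof -
  define g where "g = fps_shift 1 f"
  have f: "f = fps_X * g + 1"
  proof (rule fps_ext)
    fix n show "fps_nth f n = fps_nth (fps_X * g + 1) n"
      using assms by (cases n) (simp_all add: g_def)
  qed
  have summand: "(\<lambda>n. real (n choose k) / real n ^ j * fps_nth (g ^ k) (j - k))
      \<longlonglongrightarrow> (if k = j then fps_nth f 1 ^ j / fact j else 0)" if "k \<le> j" for k
  proof -
    have "(\<lambda>n. real (n choose k) / real n ^ k * inverse (real n) ^ (j - k) * fps_nth (g ^ k) (j - k))
      \<longlonglongrightarrow> 1 / fact k * 0 ^ (j - k) * fps_nth (g ^ k) (j - k)"
      by (intro tendsto_intros binomial_asymp lim_inverse_n)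
    also have "(\<lambda>n. real (n choose k) / real n ^ k * inverse (real n) ^ (j - k) * fps_nth (g ^ k) (j - k))
      = (\<lambda>n. real (n choose k) / real n ^ j * fps_nth (g ^ k) (j - k))"
    proof
      fix n
      have "real n ^ j = real n ^ k * real n ^ (j - k)"
        using that by (simp flip: power_add)
      thus "real (n choose k) / real n ^ k * inverse (real n) ^ (j - k) * fps_nth (g ^ k) (j - k)
        = real (n choose k) / real n ^ j * fps_nth (g ^ k) (j - k)"
        by (simp add: field_simps)
    qed
    also have "1 / fact k * 0 ^ (j - k) * fps_nth (g ^ k) (j - k)
      = (if k = j then fps_nth f 1 ^ j / fact j else 0)"
      using that by (auto simp: fps_nth_power_0 g_def)
    finally show ?thesis .
  qed
  have "(\<lambda>n. \<Sum>k\<le>j. real (n choose k) / real n ^ j * fps_nth (g ^ k) (j - k))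
      \<longlonglongrightarrow> (\<Sum>k\<le>j. if k = j then fps_nth f 1 ^ j / fact j else 0)"
    by (intro tendsto_sum summand) auto
  moreover have "eventually (\<lambda>n. (\<Sum>k\<le>j. real (n choose k) / real n ^ j * fps_nth (g ^ k) (j - k))
      = fps_nth (f ^ n) j / real n ^ j) sequentially"
    using eventually_ge_at_top[of j]
  proof eventually_elim
    case (elim n)
    have "f ^ n = (\<Sum>k\<le>n. of_nat (n choose k) * (fps_X ^ k * g ^ k))"
      unfolding f binomial_ring by (simp add: power_mult_distrib mult_ac)
    hence "fps_nth (f ^ n) j = (\<Sum>k\<le>n. real (n choose k) * (if j < k then 0 else fps_nth (g ^ k) (j - k)))"
      by (simp add: fps_sum_nth fps_X_power_mult_nth flip: fps_of_nat)
    also have "\<dots> = (\<Sum>k\<le>j. real (n choose k) * fps_nth (g ^ k) (j - k))"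
      by (rule sum.mono_neutral_cong_right) (use elim in auto)
    finally show ?case by (simp add: sum_divide_distrib)
  qed
  ultimately show ?thesis by (simp add: filterlim_cong)
qed

lemma yser_limit: "(\<lambda>n. fps_nth yser n / odf n) \<longlonglongrightarrow> exp (-2)"
proof -
  obtain C where C: "(\<lambda>n. fps_nth yser n / odf n) \<longlonglongrightarrow> C"
    using yser_limit_ex by blast
  have yterm: "(\<lambda>m. yterm m j / odf m) \<longlonglongrightarrow> C * (2 ^ j / fact j)" for j
  proof -
    \<comment> \<open>Here n stands for m - j. The coefficient of alpha^n contributes (4n)^j / j!
      since \<open>alpha\<close> starts with 1 + 4x, and passing from \<open>odf n\<close> to
      \<open>odf (n + j)\<close> divides by about (2n)^j.\<close>
    have "(\<lambda>n. fps_nth yser n / odf n * inverse (odf (n + j) / (odf n * real n ^ j))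
        * (fps_nth (alpha ^ n) j / real n ^ j)) \<longlonglongrightarrow> C * inverse (2 ^ j) * (fps_nth alpha 1 ^ j / fact j)"
      by (intro tendsto_intros C odf_add_asymp fps_power_nth_asymp alpha_nth_0) auto
    also have "C * inverse (2 ^ j) * (fps_nth alpha 1 ^ j / fact j) = C * (2 ^ j / fact j)"
    proof -
      have "(4 :: real) ^ j = 2 ^ j * 2 ^ j" by (simp flip: power_mult_distrib)
      thus ?thesis unfolding alpha_nth_1 by (simp add: field_simps)
    qed
    finally have lim: "(\<lambda>n. fps_nth yser n / odf n * inverse (odf (n + j) / (odf n * real n ^ j))
        * (fps_nth (alpha ^ n) j / real n ^ j)) \<longlonglongrightarrow> C * (2 ^ j / fact j)" .
    have "(\<lambda>n. yterm (n + j) j / odf (n + j)) \<longlonglongrightarrow> C * (2 ^ j / fact j)"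
    proof (rule Lim_transform_eventually[OF lim])
      show "eventually (\<lambda>n. fps_nth yser n / odf n * inverse (odf (n + j) / (odf n * real n ^ j))
        * (fps_nth (alpha ^ n) j / real n ^ j) = yterm (n + j) j / odf (n + j)) sequentially"
        using eventually_gt_at_top[of 0] by eventually_elim (simp add: yterm_def field_simps)
    qed
    thus ?thesis by (rule LIMSEQ_offset)
  qed
  obtain K where K: "K > 0" "\<And>m. (\<Sum>j\<le>m. real j * yterm m j) \<le> K * odf m"
    by (rule yterm_mean_bounded) blast
  \<comment> \<open>Markov's inequality bounds the part with j > J by K / (J + 1), uniformly in m.
    This allows m to tend to infinity at fixed J, and J only afterwards.\<close>
  have bound: "\<bar>1 - C * (\<Sum>j\<le>J. 2 ^ j / fact j)\<bar> \<le> K * inverse (real (Suc J))" for J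
  proof (rule LIMSEQ_le_const2)
    have "(\<lambda>m. \<bar>fps_nth Yser m / odf m - (\<Sum>j\<le>J. yterm m j / odf m)\<bar>)
        \<longlonglongrightarrow> \<bar>1 - (\<Sum>j\<le>J. C * (2 ^ j / fact j))\<bar>"
      by (intro tendsto_intros Yser_limit yterm)
    thus "(\<lambda>m. \<bar>fps_nth Yser m / odf m - (\<Sum>j\<le>J. yterm m j / odf m)\<bar>)
        \<longlonglongrightarrow> \<bar>1 - C * (\<Sum>j\<le>J. 2 ^ j / fact j)\<bar>" by (simp add: sum_distrib_left)
    show "\<exists>N. \<forall>m\<ge>N. \<bar>fps_nth Yser m / odf m - (\<Sum>j\<le>J. yterm m j / odf m)\<bar> \<le> K * inverse (real (Suc J))"
    proof (intro exI allI impI)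
      fix m assume m: "m \<ge> J"
      have split: "{..m} = {..J} \<union> {J<..m}" using m by auto
      have "fps_nth Yser m = (\<Sum>j\<le>J. yterm m j) + (\<Sum>j\<in>{J<..m}. yterm m j)"
        unfolding Yser_nth split by (rule sum.union_disjoint) auto
      hence "fps_nth Yser m / odf m - (\<Sum>j\<le>J. yterm m j / odf m) = (\<Sum>j\<in>{J<..m}. yterm m j) / odf m"
        by (simp add: sum_divide_distrib [symmetric] add_divide_distrib)
      moreover have "(\<Sum>j\<in>{J<..m}. yterm m j) \<ge> 0" by (intro sum_nonneg yterm_nonneg)
      moreover have "(\<Sum>j\<in>{J<..m}. yterm m j) \<le> K * inverse (real (Suc J)) * odf m"
      proof -
        have "real (Suc J) * (\<Sum>j\<in>{J<..m}. yterm m j) \<le> (\<Sum>j\<in>{J<..m}. real j * yterm m j)"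
          unfolding sum_distrib_left by (intro sum_mono mult_right_mono yterm_nonneg) auto
        also have "\<dots> \<le> (\<Sum>j\<le>m. real j * yterm m j)"
          by (intro sum_mono2) (auto intro!: mult_nonneg_nonneg yterm_nonneg)
        also have "\<dots> \<le> K * odf m" by (rule K)
        finally show ?thesis by (simp add: field_simps)
      qed
      ultimately show "\<bar>fps_nth Yser m / odf m - (\<Sum>j\<le>J. yterm m j / odf m)\<bar> \<le> K * inverse (real (Suc J))"
        by (simp add: pos_divide_le_eq)
    qed
  qed
  have "(\<lambda>n. 2 ^ n / fact n :: real) sums exp 2"
    using exp_converges[of "2 :: real"] by (simp add: divide_inverse mult.commute)
  hence "(\<lambda>J. \<Sum>j\<le>J. 2 ^ j / fact j :: real) \<longlonglongrightarrow> exp 2"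
    by (simp add: sums_def_le)
  hence "(\<lambda>J. \<bar>1 - C * (\<Sum>j\<le>J. 2 ^ j / fact j)\<bar>) \<longlonglongrightarrow> \<bar>1 - C * exp 2\<bar>"
    by (intro tendsto_intros)
  moreover have "(\<lambda>J. K * inverse (real (Suc J))) \<longlonglongrightarrow> K * 0"
    by (intro tendsto_intros LIMSEQ_inverse_real_of_nat)
  ultimately have "\<bar>1 - C * exp 2\<bar> \<le> K * 0"
    by (rule LIMSEQ_le) (use bound in blast)
  hence "C = exp (-2)" by (simp add: exp_minus field_simps)
  with C show ?thesis by simp
qed

section \<open>Conversion to the two stated forms of the expansion\<close>

lemma odf_diff_ratio:
  "k \<le> n \<Longrightarrow> odf (n - k) / odf n = 1 / (\<Prod>j<k. 2 * real n + 1 - 2 * real j)"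
proof (induction k)
  case (Suc k)
  obtain m where m: "n = Suc (k + m)" using Suc.prems by (metis add_Suc le_Suc_ex)
  have "odf (n - k) = (2 * real n + 1 - 2 * real k) * odf (n - Suc k)"
    by (simp add: m odf_Suc)
  moreover have "2 * real n + 1 - 2 * real k > 0" by (simp add: m)
  ultimately have "odf (n - Suc k) / odf n = odf (n - k) / odf n / (2 * real n + 1 - 2 * real k)"
    by simp
  also have "\<dots> = 1 / (\<Prod>j<Suc k. 2 * real n + 1 - 2 * real j)"
    using Suc by simp
  finally show ?case .
qed simp

lemma dfact_diff: "k \<le> n \<Longrightarrow> real (dfact (2 * n + 1 - 2 * k)) = odf (n - k)"
  by (simp add: odf_def Suc_diff_le diff_mult_distrib2)

theorem mainTheorem13:
  shows "\<exists>c :: nat \<Rightarrow> real.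
    c 0 = 1 \<and> c 1 = -6 \<and> c 2 = -4 \<and> c 3 = -(218 / 3) \<and>
    (\<forall>R :: nat.
      (\<lambda>n. fps_nth (1 - z_vertex) n -
            exp (-2) * (\<Sum>k<R. c k * real (dfact (2 * n + 1 - 2 * k))))
        \<in> O(\<lambda>n. real (dfact (2 * n + 1 - 2 * R)))) \<and>
    (\<forall>R :: nat.
      (\<lambda>n. fps_nth (1 - z_vertex) n / (exp (-2) * real (dfact (2 * n + 1))) -
            (\<Sum>k<R. c k / (\<Prod>j<k. 2 * real n + 1 - 2 * real j)))
        \<in> O(\<lambda>n. 1 / (\<Prod>j<R. 2 * real n + 1 - 2 * real j)))"
proof (intro exI[of _ "fps_nth cser"] conjI allI)
  show "fps_nth cser 0 = 1" by (rule cser_nth_0)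
  show "fps_nth cser 1 = -6" "fps_nth cser 2 = -4" "fps_nth cser 3 = -(218 / 3)"
    by (rule cser_nths)+
next
  fix R :: nat
  define e where "e = fps_nth (yrem (exp (-2)) R)"
  have e: "e \<in> O(\<lambda>n. odf (n - R))"
    unfolding e_def by (rule yrem_bigo[OF yser_limit])
  \<comment> \<open>For n < R truncated subtraction would turn the terms with k > n, absent from the
    convolution, into \<open>odf 0\<close>; the identity is only claimed from R on.\<close>
  have e_eq: "e n = fps_nth (1 - z_vertex) n - exp (-2) * (\<Sum>k<R. fps_nth cser k * odf (n - k))"
    if "n \<ge> R" for n
  proof -
    have "fps_nth (kappa * fps_cutoff R cser) n = fps_nth (fps_cutoff R cser * kappa) n"
      by (simp add: mult.commute)
    also have "\<dots> = (\<Sum>k<R. fps_nth cser k * odf (n - k))"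
      unfolding fps_mult_nth by (rule sum.mono_neutral_cong_right) (use that in auto)
    finally show ?thesis by (simp add: e_def yrem_def yser_def)
  qed
  have "e \<in> O(\<lambda>n. odf (n - R)) \<longleftrightarrow> (\<lambda>n. fps_nth (1 - z_vertex) n -
      exp (-2) * (\<Sum>k<R. fps_nth cser k * real (dfact (2 * n + 1 - 2 * k))))
      \<in> O(\<lambda>n. real (dfact (2 * n + 1 - 2 * R)))"
  proof (rule landau_o.big.cong_ex)
    show "\<forall>\<^sub>F n in at_top. e n = fps_nth (1 - z_vertex) n -
      exp (-2) * (\<Sum>k<R. fps_nth cser k * real (dfact (2 * n + 1 - 2 * k)))"
      using eventually_ge_at_top[of R]
    proof eventually_elim
      case (elim n)
      have "(\<Sum>k<R. fps_nth cser k * real (dfact (2 * n + 1 - 2 * k)))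
          = (\<Sum>k<R. fps_nth cser k * odf (n - k))"
        by (intro sum.cong refl, subst dfact_diff) (use elim in auto)
      thus ?case unfolding e_eq[OF elim] by (simp only:)
    qed
    show "\<forall>\<^sub>F n in at_top. odf (n - R) = real (dfact (2 * n + 1 - 2 * R))"
      using eventually_ge_at_top[of R] by eventually_elim (rule dfact_diff [symmetric])
  qed
  with e show "(\<lambda>n. fps_nth (1 - z_vertex) n -
      exp (-2) * (\<Sum>k<R. fps_nth cser k * real (dfact (2 * n + 1 - 2 * k))))
      \<in> O(\<lambda>n. real (dfact (2 * n + 1 - 2 * R)))" by simp
  have scale: "odf (n - R) / (exp (-2) * odf n) = exp 2 * (odf (n - R) / odf n)" for n
    by (simp add: exp_minus field_simps)
  have "(\<lambda>n. e n / (exp (-2) * odf n)) \<in> O(\<lambda>n. odf (n - R) / (exp (-2) * odf n))"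
    by (intro landau_o.big.divide_right e) auto
  hence "(\<lambda>n. e n / (exp (-2) * odf n)) \<in> O(\<lambda>n. odf (n - R) / odf n)"
    by (simp add: scale landau_o.big.cmult del: times_divide_eq_right)
  also have "?this \<longleftrightarrow> (\<lambda>n. fps_nth (1 - z_vertex) n / (exp (-2) * real (dfact (2 * n + 1))) -
            (\<Sum>k<R. fps_nth cser k / (\<Prod>j<k. 2 * real n + 1 - 2 * real j)))
        \<in> O(\<lambda>n. 1 / (\<Prod>j<R. 2 * real n + 1 - 2 * real j))"
  proof (rule landau_o.big.cong_ex)
    show "\<forall>\<^sub>F n in at_top. e n / (exp (-2) * odf n)
        = fps_nth (1 - z_vertex) n / (exp (-2) * real (dfact (2 * n + 1))) -
            (\<Sum>k<R. fps_nth cser k / (\<Prod>j<k. 2 * real n + 1 - 2 * real j))"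
      using eventually_ge_at_top[of R]
    proof eventually_elim
      case (elim n)
      have "(\<Sum>k<R. fps_nth cser k / (\<Prod>j<k. 2 * real n + 1 - 2 * real j))
          = (\<Sum>k<R. fps_nth cser k * odf (n - k)) / odf n"
        unfolding sum_divide_distrib
      proof (rule sum.cong)
        fix k assume "k \<in> {..<R}"
        hence "odf (n - k) / odf n = 1 / (\<Prod>j<k. 2 * real n + 1 - 2 * real j)"
          using elim by (intro odf_diff_ratio) auto
        thus "fps_nth cser k / (\<Prod>j<k. 2 * real n + 1 - 2 * real j)
            = fps_nth cser k * odf (n - k) / odf n"
          by (metis times_divide_eq_right mult_1_right)
      qed simp
      thus ?case unfolding e_eq[OF elim] odf_def [symmetric] by (simp add: diff_divide_distrib)
    qed
    show "\<forall>\<^sub>F n in at_top. odf (n - R) / odf n = 1 / (\<Prod>j<R. 2 * real n + 1 - 2 * real j)"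
      using eventually_ge_at_top[of R] by eventually_elim (rule odf_diff_ratio)
  qed
  finally show "(\<lambda>n. fps_nth (1 - z_vertex) n / (exp (-2) * real (dfact (2 * n + 1))) -
            (\<Sum>k<R. fps_nth cser k / (\<Prod>j<k. 2 * real n + 1 - 2 * real j)))
        \<in> O(\<lambda>n. 1 / (\<Prod>j<R. 2 * real n + 1 - 2 * real j))" .
qed

end
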